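(* Let $L$ be a domain, let $B$ be the set of elements $[(r_i,x_i)_n]$ of $B_+(\mathbb{R}_+\times L)$ such that $\{x_1,\ldots,x_n\}$ has an upper bound in $L$, and let $\mathcal{B}=\{\Downarrow[(r_i,x_i)]:[(r_i,x_i)]\in B\}\cup\{\{\bot\}\}\subseteq IV_p(L)$. Let $IV^c_p(L)$ be the Scott closure of $\mathcal{B}$ in $IV_p(L)$, with the induced order. Then $IV^c_p(L)$ is closed under the operations of $IV_p(L)$ (addition of pairs having a common upper bound in $IV^c_p(L)$, scalar multiplication by $\overline{\mathbb{R}}_{\ge0}$, and $\underline{0}$) and with the induced operations is a consistent dcpo quasi-cone; the map $\eta^c_L:L\to IV^c_p(L)$, $x\mapsto\Downarrow[(1,x)]$ (the co-restriction of $\eta_L$) is Scott continuous; and $IV^c_p(L)$ is free over $L$: for every consistent dcpo quasi-cone $Q$ and every Scott continuous map $f:L\to Q$ there is a unique homomorphism of consistent dcpo quasi-cones $\hat{f}:IV^c_p(L)\to Q$ with $\hat{f}\circ\eta^c_L=f$.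
   Context: $\mathbb{R}_+$ is the positive reals and $\overline{\mathbb{R}}_{\ge0}$ the extended non-negative reals, with the usual orders; in $\mathbb{R}_+\times L$, $(r,x)\ll(s,y)$ iff $r<s$ and $x\ll y$. $B_+(\mathbb{R}_+\times L)$ is the set of equivalence classes $[(a_1,\dots,a_n)]$ ($0<n<\omega$) of finite strings of elements of $\mathbb{R}_+\times L$ modulo permutation, plus an element $\bot$. Define $[(x_i)_n]\ll_+[(y_j)_m]$ iff there is an injective $\psi:\{1..n\}\to\{1..m\}$ with $x_i\ll y_{\psi(i)}$ for all $i$, and $\bot\ll_+b$ for all $b$. The Plotkin index power domain $IV_p(L)$ is the set of round ideals (subsets that are $\ll_+$-lower and $\ll_+$-directed) ordered by inclusion; it is a domain. For $S\subseteq B_+(\mathbb{R}_+\times L)$, $\Downarrow S=\{c:\exists b\in S,\ c\ll_+ b\}$ and $\Downarrow b=\Downarrow\{b\}$. Strings may be padded with or stripped of pairs of index $0$ (and $\bot$ is identified with the empty string). Operations on $IV_p(L)$: $R_1+R_2=\Downarrow\{[a\diamond b]:[a]\in R_1,[b]\in R_2\}$ ($\diamond$ = concatenation); for real $r\ge0$, $rR=\Downarrow\{[(rr_i,x_i)]:[(r_i,x_i)]\in R\}$, and $\infty R=\bigcup_{r\in\mathbb{R}_{\ge0}}rR$; $\underline{0}=\{\bot\}$. A consistent dcpo quasi-cone is a dcpo $Q$ with an element $\underline{0}$, a partial binary operation $+$ defined exactly on pairs $(x,y)$ having a common upper bound in $Q$ and partially Scott continuous (for directed $D$ of such pairs whose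 sup is such a pair, $+$ commutes with the sup), and a Scott continuous scalar multiplication $\overline{\mathbb{R}}_{\ge0}\times Q\to Q$, $(r,x)\mapsto rx$, such that every equation or inequation deducible (together with monotonicity of operations) from the laws $x+y=y+x$, $(x+y)+z=x+(y+z)$, $\underline{0}+x=x$, $1x=x$, $0x=\underline{0}$, $(rs)x=r(sx)$, $(r+s)x=rx+sx$ holds whenever every occurrence of $+$ in it is applied to a pair with a common upper bound. A homomorphism of consistent dcpo quasi-cones is a Scott continuous map $h$ with $h(\underline{0})=\underline{0}$, $h(rx)=rh(x)$, and $h(x+y)=h(x)+h(y)$ whenever $x,y$ have a common upper bound.
   Formalization: In the definition of consistent dcpo quasi-cone the law (r+s)x=rx+sx is replaced by r(x+y)=rx+ry: the printed law fails in IV^c_p(L) for every nonempty L, since with R=⇓[(1,x)] the set 2R has only strings of length at most 1 while R+R has strings of length 2. *)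

theory Defs
  imports
    "HOL-Analysis.Abstract_Topology"
    "HOL-Library.Multiset"
    "HOL-Library.FuncSet"
    "HOL-Library.Extended_Nonnegative_Real"
begin

section \<open>Directed-complete partial orders, domains and the Scott topology\<close>

text \<open>A poset is a carrier set together with an order relation that matters only on the carrier.\<close>

definition poset_on :: "'a set \<Rightarrow> ('a \<Rightarrow> 'a \<Rightarrow> bool) \<Rightarrow> bool" where
  "poset_on A le \<longleftrightarrow> reflp_on A le \<and> transp_on A le \<and> antisymp_on A le"

definition directed_in :: "'a set \<Rightarrow> ('a \<Rightarrow> 'a \<Rightarrow> bool) \<Rightarrow> 'a set \<Rightarrow> bool" where
  "directed_in A le D \<longleftrightarrow>
     D \<subseteq> A \<and> D \<noteq> {} \<and> (\<forall>x\<in>D. \<forall>y\<in>D. \<exists>z\<in>D. le x z \<and> le y z)"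

definition is_lub :: "'a set \<Rightarrow> ('a \<Rightarrow> 'a \<Rightarrow> bool) \<Rightarrow> 'a set \<Rightarrow> 'a \<Rightarrow> bool" where
  "is_lub A le D s \<longleftrightarrow>
     s \<in> A \<and> (\<forall>x\<in>D. le x s) \<and> (\<forall>u\<in>A. (\<forall>x\<in>D. le x u) \<longrightarrow> le s u)"

definition dcpo :: "'a set \<Rightarrow> ('a \<Rightarrow> 'a \<Rightarrow> bool) \<Rightarrow> bool" where
  "dcpo A le \<longleftrightarrow> poset_on A le \<and> (\<forall>D. directed_in A le D \<longrightarrow> (\<exists>s. is_lub A le D s))"

definition way_below :: "'a set \<Rightarrow> ('a \<Rightarrow> 'a \<Rightarrow> bool) \<Rightarrow> 'a \<Rightarrow> 'a \<Rightarrow> bool" where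
  "way_below A le x y \<longleftrightarrow> x \<in> A \<and> y \<in> A \<and>
     (\<forall>D s. directed_in A le D \<and> is_lub A le D s \<and> le y s \<longrightarrow> (\<exists>d\<in>D. le x d))"

text \<open>A domain is a continuous dcpo; it need not have a least element and may be empty.\<close>

definition continuous_dcpo :: "'a set \<Rightarrow> ('a \<Rightarrow> 'a \<Rightarrow> bool) \<Rightarrow> bool" where
  "continuous_dcpo A le \<longleftrightarrow> dcpo A le \<and>
     (\<forall>x\<in>A. directed_in A le {y. way_below A le y x} \<and> is_lub A le {y. way_below A le y x} x)"

definition scott_open :: "'a set \<Rightarrow> ('a \<Rightarrow> 'a \<Rightarrow> bool) \<Rightarrow> 'a set \<Rightarrow> bool" where
  "scott_open A le U \<longleftrightarrow> U \<subseteq> A \<and> (\<forall>x\<in>U. \<forall>y\<in>A. le x y \<longrightarrow> y \<in> U) \<and>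
     (\<forall>D s. directed_in A le D \<and> is_lub A le D s \<and> s \<in> U \<longrightarrow> D \<inter> U \<noteq> {})"

definition scott_topology :: "'a set \<Rightarrow> ('a \<Rightarrow> 'a \<Rightarrow> bool) \<Rightarrow> 'a topology" where
  "scott_topology A le = topology (scott_open A le)"

lemma istopology_scott_open: "istopology (scott_open A le)"
  unfolding istopology_def
proof (intro conjI allI impI)
  fix S T assume S: "scott_open A le S" and T: "scott_open A le T"
  show "scott_open A le (S \<inter> T)"
    unfolding scott_open_def
  proof (intro conjI allI impI)
    show "S \<inter> T \<subseteq> A" using S by (auto simp: scott_open_def)
    show "\<forall>x\<in>S \<inter> T. \<forall>y\<in>A. le x y \<longrightarrow> y \<in> S \<inter> T"
      using S T unfolding scott_open_def by blast
    fix D s assume D: "directed_in A le D \<and> is_lub A le D s \<and> s \<in> S \<inter> T"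
    obtain x where x: "x \<in> D" "x \<in> S" using D S unfolding scott_open_def by blast
    obtain y where y: "y \<in> D" "y \<in> T" using D T unfolding scott_open_def by blast
    obtain z where "z \<in> D" "le x z" "le y z" "z \<in> A"
      using D x y unfolding directed_in_def by blast
    then show "D \<inter> (S \<inter> T) \<noteq> {}" using x y S T unfolding scott_open_def by blast
  qed
next
  fix K assume K: "\<forall>S\<in>K. scott_open A le S"
  show "scott_open A le (\<Union>K)"
    unfolding scott_open_def
  proof (intro conjI allI impI)
    show "\<Union>K \<subseteq> A" using K by (auto simp: scott_open_def)
    show "\<forall>x\<in>\<Union>K. \<forall>y\<in>A. le x y \<longrightarrow> y \<in> \<Union>K"
      using K unfolding scott_open_def by (metis Union_iff)
    fix D s assume D: "directed_in A le D \<and> is_lub A le D s \<and> s \<in> \<Union>K"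
    then obtain S where S: "S \<in> K" "s \<in> S" by blast
    then have "scott_open A le S" using K by blast
    then have "D \<inter> S \<noteq> {}" using D S(2) unfolding scott_open_def by metis
    then show "D \<inter> \<Union>K \<noteq> {}" using S(1) by blast
  qed
qed

lemma openin_scott_topology: "openin (scott_topology A le) = scott_open A le"
  unfolding scott_topology_def by (simp add: istopology_scott_open)

definition scott_continuous ::
  "'a set \<Rightarrow> ('a \<Rightarrow> 'a \<Rightarrow> bool) \<Rightarrow> 'b set \<Rightarrow> ('b \<Rightarrow> 'b \<Rightarrow> bool) \<Rightarrow> ('a \<Rightarrow> 'b) \<Rightarrow> bool" where
  "scott_continuous A leA B leB f \<longleftrightarrow> f \<in> A \<rightarrow> B \<and>
     (\<forall>D s. directed_in A leA D \<and> is_lub A leA D s \<longrightarrow> is_lub B leB (f ` D) (f s))"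

definition consistent :: "'a set \<Rightarrow> ('a \<Rightarrow> 'a \<Rightarrow> bool) \<Rightarrow> 'a \<Rightarrow> 'a \<Rightarrow> bool" where
  "consistent A le x y \<longleftrightarrow> x \<in> A \<and> y \<in> A \<and> (\<exists>u\<in>A. le x u \<and> le y u)"


section \<open>Consistent dcpo quasi-cones\<close>

text \<open>The partial addition is represented by a total function whose values are only ever used on
  pairs with a common upper bound. The scalars are extended nonnegative reals, where \<open>0 * \<infinity> = 0\<close>.\<close>

record 'q quasi_cone =
  qcarrier :: "'q set"
  qle :: "'q \<Rightarrow> 'q \<Rightarrow> bool"
  qzero :: 'q
  qadd :: "'q \<Rightarrow> 'q \<Rightarrow> 'q"
  qscale :: "ennreal \<Rightarrow> 'q \<Rightarrow> 'q"

datatype qterm = Var nat | Zero | Add qterm qterm | Scale ennreal qterm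

text \<open>The laws of a quasi-cone. Scalar multiplication distributes over the addition of vectors; the
  law \<open>(r + s) x = r x + s x\<close> is what separates cones from quasi-cones, and it is
  not included: it fails in every index power domain over a nonempty domain
  (see \<open>scalar_addition_law_fails\<close> below).\<close>

inductive quasi_cone_law :: "qterm \<Rightarrow> qterm \<Rightarrow> bool" where
  add_comm: "quasi_cone_law (Add x y) (Add y x)"
| add_assoc: "quasi_cone_law (Add (Add x y) z) (Add x (Add y z))"
| zero_add: "quasi_cone_law (Add Zero x) x"
| one_scale: "quasi_cone_law (Scale 1 x) x"
| zero_scale: "quasi_cone_law (Scale 0 x) Zero"
| mult_scale: "quasi_cone_law (Scale (r * s) x) (Scale r (Scale s x))"
| scale_add: "quasi_cone_law (Scale r (Add x y)) (Add (Scale r x) (Scale r y))"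

text \<open>The inequations deducible from the laws and monotonicity of the operations; an equation is
  deducible iff both of its inequations are. The terms occurring inside a deduction need
  not be defined in the quasi-cone in which its conclusion is interpreted.\<close>

inductive deducible :: "qterm \<Rightarrow> qterm \<Rightarrow> bool" where
  law: "quasi_cone_law s t \<Longrightarrow> deducible s t"
| law_sym: "quasi_cone_law s t \<Longrightarrow> deducible t s"
| refl: "deducible t t"
| trans: "deducible s t \<Longrightarrow> deducible t u \<Longrightarrow> deducible s u"
| add_mono: "deducible s s' \<Longrightarrow> deducible t t' \<Longrightarrow> deducible (Add s t) (Add s' t')"
| scale_mono: "r \<le> r' \<Longrightarrow> deducible t t' \<Longrightarrow> deducible (Scale r t) (Scale r' t')"

primrec eval_term :: "'q quasi_cone \<Rightarrow> (nat \<Rightarrow> 'q) \<Rightarrow> qterm \<Rightarrow> 'q" where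
  "eval_term Q \<rho> (Var i) = \<rho> i"
| "eval_term Q \<rho> Zero = qzero Q"
| "eval_term Q \<rho> (Add s t) = qadd Q (eval_term Q \<rho> s) (eval_term Q \<rho> t)"
| "eval_term Q \<rho> (Scale r t) = qscale Q r (eval_term Q \<rho> t)"

primrec defined_term :: "'q quasi_cone \<Rightarrow> (nat \<Rightarrow> 'q) \<Rightarrow> qterm \<Rightarrow> bool" where
  "defined_term Q \<rho> (Var i) \<longleftrightarrow> True"
| "defined_term Q \<rho> Zero \<longleftrightarrow> True"
| "defined_term Q \<rho> (Add s t) \<longleftrightarrow> defined_term Q \<rho> s \<and> defined_term Q \<rho> t \<and>
     consistent (qcarrier Q) (qle Q) (eval_term Q \<rho> s) (eval_term Q \<rho> t)"
| "defined_term Q \<rho> (Scale r t) \<longleftrightarrow> defined_term Q \<rho> t"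

definition consistent_dcpo_quasi_cone :: "'q quasi_cone \<Rightarrow> bool" where
  "consistent_dcpo_quasi_cone Q \<longleftrightarrow>
     dcpo (qcarrier Q) (qle Q) \<and>
     qzero Q \<in> qcarrier Q \<and>
     (\<forall>x y. consistent (qcarrier Q) (qle Q) x y \<longrightarrow> qadd Q x y \<in> qcarrier Q) \<and>
     (\<forall>D x y. directed_in (qcarrier Q \<times> qcarrier Q) (rel_prod (qle Q) (qle Q)) D \<and>
        (\<forall>(a, b)\<in>D. consistent (qcarrier Q) (qle Q) a b) \<and>
        is_lub (qcarrier Q \<times> qcarrier Q) (rel_prod (qle Q) (qle Q)) D (x, y) \<and>
        consistent (qcarrier Q) (qle Q) x y \<longrightarrow>
        is_lub (qcarrier Q) (qle Q) ((\<lambda>(a, b). qadd Q a b) ` D) (qadd Q x y)) \<and>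
     scott_continuous ((UNIV :: ennreal set) \<times> qcarrier Q) (rel_prod (\<le>) (qle Q))
        (qcarrier Q) (qle Q) (\<lambda>(r, x). qscale Q r x) \<and>
     (\<forall>s t \<rho>. deducible s t \<and> range \<rho> \<subseteq> qcarrier Q \<and>
        defined_term Q \<rho> s \<and> defined_term Q \<rho> t \<longrightarrow>
        qle Q (eval_term Q \<rho> s) (eval_term Q \<rho> t))"

definition quasi_cone_hom :: "'p quasi_cone \<Rightarrow> 'q quasi_cone \<Rightarrow> ('p \<Rightarrow> 'q) \<Rightarrow> bool" where
  "quasi_cone_hom P Q h \<longleftrightarrow>
     scott_continuous (qcarrier P) (qle P) (qcarrier Q) (qle Q) h \<and>
     h (qzero P) = qzero Q \<and>
     (\<forall>r. \<forall>x\<in>qcarrier P. h (qscale P r x) = qscale Q r (h x)) \<and>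
     (\<forall>x y. consistent (qcarrier P) (qle P) x y \<longrightarrow> h (qadd P x y) = qadd Q (h x) (h y))"


section \<open>The Plotkin index power domain\<close>

text \<open>Strings modulo permutation are finite multisets; \<open>\<bottom>\<close> is the empty multiset \<open>{#}\<close>.\<close>

definition B_plus :: "'a set \<Rightarrow> (real \<times> 'a) multiset set" where
  "B_plus L = {b. set_mset b \<subseteq> {0<..} \<times> L}"

definition ll_plus ::
  "'a set \<Rightarrow> ('a \<Rightarrow> 'a \<Rightarrow> bool) \<Rightarrow> (real \<times> 'a) multiset \<Rightarrow> (real \<times> 'a) multiset \<Rightarrow> bool" where
  "ll_plus L le a b \<longleftrightarrow>
     (\<exists>xs ys \<psi>. mset xs = a \<and> mset ys = b \<and>
        inj_on \<psi> {..<length xs} \<and> \<psi> ` {..<length xs} \<subseteq> {..<length ys} \<and>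
        (\<forall>i<length xs. rel_prod (<) (way_below L le) (xs ! i) (ys ! \<psi> i)))"

definition DDown ::
  "'a set \<Rightarrow> ('a \<Rightarrow> 'a \<Rightarrow> bool) \<Rightarrow> (real \<times> 'a) multiset set \<Rightarrow> (real \<times> 'a) multiset set" where
  "DDown L le S = {c \<in> B_plus L. \<exists>b\<in>S. ll_plus L le c b}"

definition IV :: "'a set \<Rightarrow> ('a \<Rightarrow> 'a \<Rightarrow> bool) \<Rightarrow> (real \<times> 'a) multiset set set" where
  "IV L le = {R. R \<subseteq> B_plus L \<and>
     (\<forall>a\<in>B_plus L. \<forall>b\<in>R. ll_plus L le a b \<longrightarrow> a \<in> R) \<and>
     R \<noteq> {} \<and> (\<forall>a\<in>R. \<forall>b\<in>R. \<exists>c\<in>R. ll_plus L le a c \<and> ll_plus L le b c)}"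

definition IV_zero :: "(real \<times> 'a) multiset set" where
  "IV_zero = {{#}}"

definition IV_add :: "'a set \<Rightarrow> ('a \<Rightarrow> 'a \<Rightarrow> bool) \<Rightarrow>
    (real \<times> 'a) multiset set \<Rightarrow> (real \<times> 'a) multiset set \<Rightarrow> (real \<times> 'a) multiset set" where
  "IV_add L le R S = DDown L le {a + b | a b. a \<in> R \<and> b \<in> S}"

text \<open>Pairs whose index becomes \<open>0\<close> are stripped.\<close>

definition scale_bag :: "real \<Rightarrow> (real \<times> 'a) multiset \<Rightarrow> (real \<times> 'a) multiset" where
  "scale_bag r a = filter_mset (\<lambda>(s, x). s \<noteq> 0) (image_mset (\<lambda>(s, x). (r * s, x)) a)"

definition IV_scale_real :: "'a set \<Rightarrow> ('a \<Rightarrow> 'a \<Rightarrow> bool) \<Rightarrow>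
    real \<Rightarrow> (real \<times> 'a) multiset set \<Rightarrow> (real \<times> 'a) multiset set" where
  "IV_scale_real L le r R = DDown L le (scale_bag r ` R)"

definition IV_scale :: "'a set \<Rightarrow> ('a \<Rightarrow> 'a \<Rightarrow> bool) \<Rightarrow>
    ennreal \<Rightarrow> (real \<times> 'a) multiset set \<Rightarrow> (real \<times> 'a) multiset set" where
  "IV_scale L le r R =
     (if r = \<infinity> then \<Union>s\<in>{0..}. IV_scale_real L le s R else IV_scale_real L le (enn2real r) R)"

definition eta :: "'a set \<Rightarrow> ('a \<Rightarrow> 'a \<Rightarrow> bool) \<Rightarrow> 'a \<Rightarrow> (real \<times> 'a) multiset set" where
  "eta L le x = DDown L le {{#(1, x)#}}"

lemma ll_plus_size:
  assumes "ll_plus L le a b"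
  shows "size a \<le> size b"
proof -
  obtain xs ys \<psi> where *: "mset xs = a" "mset ys = b"
    "inj_on \<psi> {..<length xs}" "\<psi> ` {..<length xs} \<subseteq> {..<length ys}"
    using assms unfolding ll_plus_def by metis
  then have "length xs \<le> length ys" using card_inj_on_le[of \<psi> "{..<length xs}" "{..<length ys}"] by simp
  then show ?thesis using * by auto
qed

lemma scalar_addition_law_fails:
  assumes "continuous_dcpo L le" "x \<in> L"
  shows "IV_scale L le (1 + 1) (eta L le x)
    \<noteq> IV_add L le (IV_scale L le 1 (eta L le x)) (IV_scale L le 1 (eta L le x))"
proof -
  have below: "\<exists>z. way_below L le z y" if "y \<in> L" for y
  proof -
    have "directed_in L le {z. way_below L le z y}"
      using assms(1) that by (simp add: continuous_dcpo_def)
    then show ?thesis by (auto simp: directed_in_def)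
  qed
  have wb: "y \<in> L" "z \<in> L" if "way_below L le z y" for y z
    using that by (auto simp: way_below_def)
  obtain x1 where x1: "way_below L le x1 x" using below assms(2) by blast
  obtain x2 where x2: "way_below L le x2 x1" using below wb(2)[OF x1] by blast
  obtain x3 where x3: "way_below L le x3 x2" using below wb(2)[OF x2] by blast
  have single: "ll_plus L le {#(r, y)#} {#(s, z)#}" if "r < s" "way_below L le y z" for r s y z
    unfolding ll_plus_def
    by (rule exI[of _ "[(r, y)]"], rule exI[of _ "[(s, z)]"], rule exI[of _ id]) (use that in auto)
  have double: "ll_plus L le {#(r, y), (r, y)#} ({#(s, z)#} + {#(s, z)#})"
    if "r < s" "way_below L le y z" for r s y z
    unfolding ll_plus_def
    by (rule exI[of _ "[(r, y), (r, y)]"], rule exI[of _ "[(s, z), (s, z)]"], rule exI[of _ id])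
      (use that in \<open>auto simp: less_Suc_eq\<close>)
  have "{#(1/2, x1)#} \<in> eta L le x"
    using single[OF _ x1, of "1/2" 1] wb(2)[OF x1] by (simp add: eta_def DDown_def B_plus_def)
  then have "scale_bag 1 {#(1/2, x1)#} \<in> scale_bag 1 ` eta L le x" by (rule imageI)
  then have a: "{#(1/2, x1)#} \<in> scale_bag 1 ` eta L le x" by (simp add: scale_bag_def)
  have b: "{#(1/4, x2)#} \<in> IV_scale L le 1 (eta L le x)"
  proof -
    have "{#(1/4, x2)#} \<in> B_plus L" using wb(2)[OF x2] by (simp add: B_plus_def)
    moreover have "ll_plus L le {#(1/4, x2)#} {#(1/2, x1)#}" by (rule single[OF _ x2]) simp
    ultimately have "{#(1/4, x2)#} \<in> IV_scale_real L le 1 (eta L le x)"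
      using a unfolding IV_scale_real_def DDown_def by blast
    then show ?thesis by (simp add: IV_scale_def)
  qed
  let ?R = "IV_scale L le 1 (eta L le x)"
  have "{#(1/4, x2)#} + {#(1/4, x2)#} \<in> {a + b | a b. a \<in> ?R \<and> b \<in> ?R}"
    using b by blast
  moreover have "ll_plus L le {#(1/8, x3), (1/8, x3)#} ({#(1/4, x2)#} + {#(1/4, x2)#})"
    by (rule double[OF _ x3]) simp
  moreover have "{#(1/8, x3), (1/8, x3)#} \<in> B_plus L"
    using wb(2)[OF x3] by (simp add: B_plus_def)
  ultimately have "{#(1/8, x3), (1/8, x3)#} \<in> IV_add L le ?R ?R"
    unfolding IV_add_def DDown_def by blast
  moreover have "size c \<le> 1" if c: "c \<in> IV_scale L le (1 + 1) (eta L le x)" for c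
  proof -
    obtain d r where d: "d \<in> eta L le x" "ll_plus L le c (scale_bag r d)"
      using c unfolding IV_scale_def IV_scale_real_def DDown_def
      by (auto split: if_splits)
    have "size d \<le> size {#(1 :: real, x)#}"
      using d(1) unfolding eta_def DDown_def by (blast intro: ll_plus_size)
    moreover have "size (scale_bag r d) \<le> size d"
      unfolding scale_bag_def using size_filter_mset_lesseq by (metis size_image_mset)
    ultimately show ?thesis using ll_plus_size[OF d(2)] by simp
  qed
  then have "\<not> 2 \<le> size c" if "c \<in> IV_scale L le (1 + 1) (eta L le x)" for c
    using that by fastforce
  ultimately show ?thesis
    by (metis size_add_mset size_empty One_nat_def Suc_1 order_refl)
qed


section \<open>The consistent part of the index power domain\<close>

definition bounded_strings :: "'a set \<Rightarrow> ('a \<Rightarrow> 'a \<Rightarrow> bool) \<Rightarrow> (real \<times> 'a) multiset set" where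
  "bounded_strings L le =
     {b \<in> B_plus L. b \<noteq> {#} \<and> (\<exists>u\<in>L. \<forall>x\<in>snd ` set_mset b. le x u)}"

definition bounded_basis :: "'a set \<Rightarrow> ('a \<Rightarrow> 'a \<Rightarrow> bool) \<Rightarrow> (real \<times> 'a) multiset set set" where
  "bounded_basis L le = {DDown L le {b} | b. b \<in> bounded_strings L le} \<union> {{{#}}}"

definition IVc :: "'a set \<Rightarrow> ('a \<Rightarrow> 'a \<Rightarrow> bool) \<Rightarrow> (real \<times> 'a) multiset set set" where
  "IVc L le = scott_topology (IV L le) (\<subseteq>) closure_of (bounded_basis L le)"

definition IVc_cone ::
  "'a set \<Rightarrow> ('a \<Rightarrow> 'a \<Rightarrow> bool) \<Rightarrow> (real \<times> 'a) multiset set quasi_cone" where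
  "IVc_cone L le = \<lparr>qcarrier = IVc L le, qle = (\<subseteq>), qzero = IV_zero,
     qadd = IV_add L le, qscale = IV_scale L le\<rparr>"

end

theory Submission
  imports Defs
begin

text \<open>Since round ideals have no maximal elements, the operations on them need no down-closure:
  \<open>R + S\<close> consists of the strings \<open>a + b\<close> with \<open>a \<in> R\<close> and \<open>b \<in> S\<close>, and, uniformly for all
  \<open>r \<le> \<infinity>\<close>, \<open>r R\<close> consists of \<open>\<bottom>\<close> and the \<open>t b\<close> with \<open>0 < t < r\<close> and \<open>b \<in> R\<close>. With these
  descriptions the laws and the continuity of the operations are elementary. The Scott
  closure of \<open>bounded_basis\<close> consists of the round ideals whose strings are all bounded. On a bounded
  string the sum \<open>r\<^sub>1 f(x\<^sub>1) + \<dots> + r\<^sub>n f(x\<^sub>n)\<close> exists in every consistent dcpo quasi-cone, because all its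
  summands lie below \<open>\<infinity> f(u)\<close>; the extension of \<open>f\<close> maps \<open>R\<close> to the supremum of these sums over
  \<open>R\<close>, and it is unique because every member of the closure is the directed union of the sums
  \<open>\<Down>b = r\<^sub>1 \<eta>(x\<^sub>1) + \<dots> + r\<^sub>n \<eta>(x\<^sub>n)\<close> of its strings \<open>b\<close>.\<close>

section \<open>Multiset embeddings\<close>

text \<open>The obstacle throughout is partiality. A deduction may pass through sums that do not
  exist in the closure, so it cannot be followed step by step there; it is followed in all of
  \<open>IV L le\<close>, where addition is total. In the target cone no ambient total algebra is
  available, and without the law \<open>(r + s) x = r x + s x\<close> the element \<infinity> f(u)
  need not absorb itself: a sum of two elements below it need not lie below it again. Sums of
  bounded strings survive because every element is consistent with itself, so that an upper bound
  can always be doubled. The description of scalar multiples rests on the strict order of the real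
  indices: a string of a round ideal can be multiplied by some factor above 1 without leaving the
  ideal. The index order is generated inductively on multisets, because splitting, interpolation and
  scaling all act on one matched pair at a time, which is awkward to express with lists and
  injections.\<close>

inductive mset_emb :: "('a \<Rightarrow> 'b \<Rightarrow> bool) \<Rightarrow> 'a multiset \<Rightarrow> 'b multiset \<Rightarrow> bool" for P where
  mset_emb_empty: "mset_emb P {#} b"
| mset_emb_add: "P x y \<Longrightarrow> mset_emb P a b \<Longrightarrow> mset_emb P (add_mset x a) (add_mset y b)"

lemma mset_emb_add_right: "mset_emb P a b \<Longrightarrow> mset_emb P a (add_mset y b)"
proof (induction rule: mset_emb.induct)
  case (mset_emb_add x z a b)
  then show ?case
    using mset_emb.mset_emb_add[of P x z a "add_mset y b"] by (simp add: add_mset_commute)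
qed (rule mset_emb_empty)

text \<open>Inversion at a chosen element of the target. The last rule may have matched another
  element \<open>z\<close>; then \<open>y\<close> is found in the remaining target by induction, and
  the two elements of the source commute.\<close>

lemma mset_emb_add_rightD:
  assumes "mset_emb P a (add_mset y b)"
  shows "mset_emb P a b \<or> (\<exists>x a'. a = add_mset x a' \<and> P x y \<and> mset_emb P a' b)"
  using assms
proof (induction a "add_mset y b" arbitrary: b rule: mset_emb.induct)
  case mset_emb_empty
  then show ?case by (simp add: mset_emb.mset_emb_empty)
next
  case (mset_emb_add x z a b0)
  from \<open>add_mset z b0 = add_mset y b\<close> consider "z = y" "b0 = b"
    | k where "b0 = add_mset y k" "b = add_mset z k"
    by (auto simp: add_eq_conv_ex)
  then show ?case
  proof cases
    case 1
    then show ?thesis using mset_emb_add by blast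
  next
    case 2
    from mset_emb_add.hyps(3)[OF 2(1)] show ?thesis
    proof (elim disjE exE conjE)
      assume "mset_emb P a k"
      then have "mset_emb P (add_mset x a) b"
        unfolding 2(2) by (rule mset_emb.mset_emb_add[of P, OF mset_emb_add.hyps(1)])
      then show ?thesis by (rule disjI1)
    next
      fix x' a' assume a: "a = add_mset x' a'" "P x' y" "mset_emb P a' k"
      have "mset_emb P (add_mset x a') b"
        unfolding 2(2) by (rule mset_emb.mset_emb_add[of P, OF mset_emb_add.hyps(1) a(3)])
      moreover have "add_mset x a = add_mset x' (add_mset x a')"
        unfolding a(1) by (rule add_mset_commute)
      ultimately show ?thesis using a(2) by metis
    qed
  qed
qed

lemma mset_emb_add_right_iff:
  "mset_emb P a (add_mset y b) \<longleftrightarrow>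
     mset_emb P a b \<or> (\<exists>x a'. a = add_mset x a' \<and> P x y \<and> mset_emb P a' b)"
  by (rule iffI, erule mset_emb_add_rightD) (auto intro: mset_emb_add_right mset_emb_add)

lemma mset_emb_empty_right [simp]: "mset_emb P a {#} \<longleftrightarrow> a = {#}"
  by (auto elim: mset_emb.cases intro: mset_emb_empty)

lemma mset_emb_plus:
  "mset_emb P a b \<Longrightarrow> mset_emb P a' b' \<Longrightarrow> mset_emb P (a + a') (b + b')"
proof (induction rule: mset_emb.induct)
  case (mset_emb_empty b)
  then show ?case by (induction b) (auto intro: mset_emb_add_right)
next
  case (mset_emb_add x y a b)
  then show ?case by (simp add: mset_emb.mset_emb_add)
qed

text \<open>Each element of the source follows its partner into \<open>a\<close> or
  \<open>b\<close>. This splitting is what makes a string below a concatenation a concatenation of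
  strings below.\<close>

lemma mset_emb_plus_right:
  assumes "mset_emb P c (a + b)"
  obtains c1 c2 where "c = c1 + c2" "mset_emb P c1 a" "mset_emb P c2 b"
proof -
  have "\<exists>c1 c2. c = c1 + c2 \<and> mset_emb P c1 a \<and> mset_emb P c2 b"
    using assms
  proof (induction a arbitrary: c)
    case empty
    then show ?case by (auto intro: mset_emb_empty)
  next
    case (add y a)
    from add.prems have "mset_emb P c (add_mset y (a + b))" by simp
    then show ?case
      unfolding mset_emb_add_right_iff[of P c]
    proof (elim disjE exE conjE)
      assume "mset_emb P c (a + b)"
      then obtain c1 c2 where "c = c1 + c2" "mset_emb P c1 a" "mset_emb P c2 b"
        using add.IH by metis
      then show ?thesis by (intro exI[of _ c1] exI[of _ c2]) (simp add: mset_emb_add_right)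
    next
      fix x c' assume *: "c = add_mset x c'" "P x y" "mset_emb P c' (a + b)"
      then obtain c1 c2 where "c' = c1 + c2" "mset_emb P c1 a" "mset_emb P c2 b"
        using add.IH by blast
      then have "c = add_mset x c1 + c2" "mset_emb P (add_mset x c1) (add_mset y a)"
        using * by (auto intro: mset_emb_add)
      then show ?thesis using \<open>mset_emb P c2 b\<close> by blast
    qed
  qed
  then show thesis using that by blast
qed

lemma mset_emb_trans:
  assumes "mset_emb P a b" "mset_emb P' b c" "\<And>x y z. P x y \<Longrightarrow> P' y z \<Longrightarrow> P'' x z"
  shows "mset_emb P'' a c"
  using assms(2,1)
proof (induction arbitrary: a rule: mset_emb.induct)
  case (mset_emb_empty b)
  then show ?case by (auto intro: mset_emb.mset_emb_empty)
next
  case (mset_emb_add x y b c)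
  from mset_emb_add.prems show ?case
    unfolding mset_emb_add_right_iff[of P a]
  proof (elim disjE exE conjE)
    assume "mset_emb P a b"
    then show ?thesis by (intro mset_emb_add_right mset_emb_add.IH)
  next
    fix w a' assume "a = add_mset w a'" and w: "P w x" and a': "mset_emb P a' b"
    then show ?thesis
      using mset_emb.mset_emb_add[OF assms(3)[OF w mset_emb_add.hyps(1)] mset_emb_add.IH[OF a']]
      by simp
  qed
qed

lemma mset_emb_image:
  assumes "mset_emb P a b" "\<And>x y. x \<in># a \<Longrightarrow> y \<in># b \<Longrightarrow> P x y \<Longrightarrow> P' (f x) (g y)"
  shows "mset_emb P' (image_mset f a) (image_mset g b)"
  using assms
proof (induction rule: mset_emb.induct)
  case (mset_emb_add x y a b)
  have "mset_emb P' (image_mset f a) (image_mset g b)"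
    by (rule mset_emb_add.IH) (use mset_emb_add.prems in auto)
  then show ?case using mset_emb_add by (auto intro!: mset_emb.mset_emb_add)
qed (auto intro: mset_emb_empty)

text \<open>The entries of \<open>ys\<close> at positions hit by \<psi> form a sub-multiset of the
  target because \<psi> is injective. Listed in the order given by \<psi> they match
  \<open>xs\<close> position by position; the entries not hit are added as partners of the empty
  multiset.\<close>

lemma mset_emb_mset:
  assumes "inj_on \<psi> {..<length xs}" "\<psi> ` {..<length xs} \<subseteq> {..<length ys}"
    "\<forall>i<length xs. P (xs ! i) (ys ! \<psi> i)"
  shows "mset_emb P (mset xs) (mset ys)"
proof -
  let ?n = "length xs"
  have sub: "image_mset ((!) ys) (mset_set (\<psi> ` {..<?n})) \<subseteq># mset ys"
  proof -
    have "mset_set (\<psi> ` {..<?n}) \<subseteq># mset_set {..<length ys}"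
      using assms(2) by (simp add: subset_imp_msubset_mset_set)
    moreover have "image_mset ((!) ys) (mset_set {..<length ys}) = mset ys"
      by (metis atLeast_upt map_nth mset_map mset_set_upto_eq_mset_upto)
    ultimately show ?thesis by (metis image_mset_subseteq_mono)
  qed
  have eq: "image_mset ((!) ys) (mset_set (\<psi> ` {..<?n})) = mset (map (\<lambda>i. ys ! \<psi> i) [0..<?n])"
    using assms(1) image_mset_mset_set[of \<psi> "{..<?n}"]
    by (metis (no_types, lifting) ext atLeast_upt comp_def image_mset.compositionality mset_map
        mset_set_upto_eq_mset_upto)
  have "list_all2 P xs zs \<Longrightarrow> mset_emb P (mset xs) (mset zs)" for zs
    by (induction rule: list_all2_induct) (auto intro: mset_emb.intros)
  moreover have "list_all2 P xs (map (\<lambda>i. ys ! \<psi> i) [0..<?n])"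
    using assms(3) by (simp add: list_all2_conv_all_nth)
  ultimately have "mset_emb P (mset xs) (mset (map (\<lambda>i. ys ! \<psi> i) [0..<?n]))" by blast
  moreover obtain c where "mset ys = mset (map (\<lambda>i. ys ! \<psi> i) [0..<?n]) + c"
    using sub eq by (metis mset_subset_eq_exists_conv)
  ultimately show ?thesis
    using mset_emb_plus[OF _ mset_emb_empty] by fastforce
qed

text \<open>Gives access to rule induction. For the converse, matched pairs are listed in the same
  order, so that the identity serves as \<psi>.\<close>

lemma ll_plus_eq: "ll_plus L le = mset_emb (rel_prod (<) (way_below L le))"
proof (intro ext iffI)
  fix a b
  assume "ll_plus L le a b"
  then show "mset_emb (rel_prod (<) (way_below L le)) a b"
    unfolding ll_plus_def by (auto intro: mset_emb_mset)
next
  let ?P = "rel_prod (<) (way_below L le) :: real \<times> 'a \<Rightarrow> _"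
  fix a b
  assume "mset_emb ?P a b"
  then have "\<exists>xs ys. mset xs = a \<and> mset ys = b \<and> length xs \<le> length ys \<and>
    (\<forall>i<length xs. ?P (xs ! i) (ys ! i))"
  proof (induction rule: mset_emb.induct)
    case (mset_emb_empty b)
    then show ?case by (metis ex_mset length_0_conv less_nat_zero_code mset.simps(1) zero_le)
  next
    case (mset_emb_add x y a b)
    then obtain xs ys where "mset xs = a" "mset ys = b" "length xs \<le> length ys"
      "\<forall>i<length xs. ?P (xs ! i) (ys ! i)" by blast
    then have "mset (x # xs) = add_mset x a" "mset (y # ys) = add_mset y b"
      "length (x # xs) \<le> length (y # ys)"
      "\<forall>i<length (x # xs). ?P ((x # xs) ! i) ((y # ys) ! i)"
      using mset_emb_add.hyps(1) by (auto simp: nth_Cons')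
    then show ?case by blast
  qed
  then show "ll_plus L le a b"
    unfolding ll_plus_def by (metis id_apply image_id inj_on_id lessThan_subset_iff)
qed

section \<open>Interpolation in a continuous dcpo\<close>

lemma is_lub_unique:
  "poset_on A le \<Longrightarrow> is_lub A le D s \<Longrightarrow> is_lub A le D t \<Longrightarrow> s = t"
  unfolding poset_on_def is_lub_def antisymp_on_def by blast

text \<open>The common source of monotonicity: continuity, or the definition of way-below, is
  applied to a two-element chain.\<close>

lemma is_lub_directed_pair:
  assumes "reflp_on A le" "x \<in> A" "y \<in> A" "le x y"
  shows "directed_in A le {x, y}" "is_lub A le {x, y} y"
  using assms unfolding directed_in_def is_lub_def reflp_on_def by auto

lemma scott_continuousD:
  "scott_continuous A le B le' f \<Longrightarrow> directed_in A le D \<Longrightarrow> is_lub A le D s \<Longrightarrow>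
     is_lub B le' (f ` D) (f s)"
  unfolding scott_continuous_def by blast

lemma scott_continuous_mono:
  assumes "scott_continuous A le B le' f" "reflp_on A le" "x \<in> A" "y \<in> A" "le x y"
  shows "le' (f x) (f y)"
  using scott_continuousD[OF assms(1) is_lub_directed_pair[OF assms(2-)]]
  unfolding is_lub_def by simp

lemma directed_in_image:
  assumes "directed_in A le D" "\<And>x. x \<in> D \<Longrightarrow> f x \<in> B"
    "\<And>x y. x \<in> D \<Longrightarrow> y \<in> D \<Longrightarrow> le x y \<Longrightarrow> le' (f x) (f y)"
  shows "directed_in B le' (f ` D)"
  unfolding directed_in_def
proof (intro conjI ballI)
  show "f ` D \<subseteq> B" "f ` D \<noteq> {}" using assms unfolding directed_in_def by auto
  fix u v assume "u \<in> f ` D" "v \<in> f ` D"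
  then obtain x y where "x \<in> D" "y \<in> D" "u = f x" "v = f y" by blast
  then show "\<exists>z\<in>f ` D. le' u z \<and> le' v z"
    using assms unfolding directed_in_def by (metis (no_types, lifting) imageI)
qed

text \<open>An upper bound \<open>u\<close> of the first projection yields the upper bound
  \<open>(u, y)\<close> of \<open>D\<close>, and symmetrically for the second.\<close>

lemma is_lub_prodD:
  assumes "is_lub (A \<times> B) (rel_prod le le') D (x, y)"
  shows "is_lub A le (fst ` D) x" "is_lub B le' (snd ` D) y"
  using assms unfolding is_lub_def by (auto simp: rel_prod_sel)

lemma is_lub_prodI:
  assumes "is_lub A le (fst ` D) x" "is_lub B le' (snd ` D) y"
  shows "is_lub (A \<times> B) (rel_prod le le') D (x, y)"
  using assms unfolding is_lub_def by (auto simp: rel_prod_sel)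

lemma directed_in_prodD:
  assumes "directed_in (A \<times> B) (rel_prod le le') D"
  shows "directed_in A le (fst ` D)" "directed_in B le' (snd ` D)"
proof -
  have D: "D \<subseteq> A \<times> B" using assms by (simp add: directed_in_def)
  show "directed_in A le (fst ` D)"
    by (rule directed_in_image[OF assms]) (use D in \<open>auto simp: rel_prod_sel\<close>)
  show "directed_in B le' (snd ` D)"
    by (rule directed_in_image[OF assms]) (use D in \<open>auto simp: rel_prod_sel\<close>)
qed

lemma directed_in_Times:
  assumes "directed_in A le D" "directed_in B le' E"
  shows "directed_in (A \<times> B) (rel_prod le le') (D \<times> E)"
  unfolding directed_in_def
proof (intro conjI ballI)
  show "D \<times> E \<subseteq> A \<times> B" "D \<times> E \<noteq> {}" using assms by (auto simp: directed_in_def)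
  fix p q assume pq: "p \<in> D \<times> E" "q \<in> D \<times> E"
  obtain x where "x \<in> D" "le (fst p) x" "le (fst q) x"
    using assms(1) pq by (metis directed_in_def mem_Times_iff)
  moreover obtain y where "y \<in> E" "le' (snd p) y" "le' (snd q) y"
    using assms(2) pq by (metis directed_in_def mem_Times_iff)
  ultimately show "\<exists>z\<in>D \<times> E. rel_prod le le' p z \<and> rel_prod le le' q z"
    by (intro bexI[of _ "(x, y)"]) (simp_all add: rel_prod_sel)
qed

lemma is_lub_Times:
  assumes "is_lub A le D x" "is_lub B le' E y" "D \<noteq> {}" "E \<noteq> {}"
  shows "is_lub (A \<times> B) (rel_prod le le') (D \<times> E) (x, y)"
  using assms by (intro is_lub_prodI) simp_all

section \<open>Strict inequalities between extended non-negative reals\<close>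

lemma ennreal_less_ex_le:
  assumes "0 \<le> u" "ennreal u < r"
  obtains u' where "u < u'" "ennreal u' \<le> r"
proof (cases r)
  case (real x)
  then show ?thesis using assms that[of x] by (simp add: ennreal_less_iff)
next
  case top
  then show ?thesis using that[of "u + 1"] by simp
qed

lemma ennreal_ex_pos_less:
  assumes "r \<noteq> 0"
  obtains u where "0 < u" "ennreal u < r"
proof -
  obtain u' where "0 < u'" "ennreal u' \<le> r"
    using ennreal_less_ex_le[of 0 r] assms by (auto simp: zero_less_iff_neq_zero)
  then have "0 < u' / 2" "ennreal (u' / 2) < r"
    using ennreal_lessI[of u' "u' / 2"] by (auto intro: order_less_le_trans)
  then show thesis using that by blast
qed

text \<open>The arithmetic behind the law for products of scalars. If reals \<open>p\<close> and
  \<open>q\<close> below \<open>r\<close> and \<open>s\<close> satisfy \<open>t < p * q\<close>,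
  then any \<open>u\<close> strictly between \<open>t / q\<close> and \<open>p\<close> works
  together with \<open>v = t / u\<close>. The remaining cases only find such \<open>p\<close> and
  \<open>q\<close> when a factor is infinite.\<close>

lemma ennreal_less_mult_iff:
  assumes "0 < t"
  shows "ennreal t < r * s \<longleftrightarrow> (\<exists>u v. 0 < u \<and> 0 < v \<and> t = u * v \<and> ennreal u < r \<and> ennreal v < s)"
proof
  assume "\<exists>u v. 0 < u \<and> 0 < v \<and> t = u * v \<and> ennreal u < r \<and> ennreal v < s"
  then show "ennreal t < r * s"
  proof (elim exE conjE)
    fix u v assume uv: "0 < u" "0 < v" "t = u * v" "ennreal u < r" "ennreal v < s"
    obtain u' where u': "u < u'" "ennreal u' \<le> r"
      by (rule ennreal_less_ex_le[OF less_imp_le[OF uv(1)] uv(4)])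
    obtain v' where v': "v < v'" "ennreal v' \<le> s"
      by (rule ennreal_less_ex_le[OF less_imp_le[OF uv(2)] uv(5)])
    have "u * v < u' * v'" using uv u' v' by (intro mult_strict_mono) auto
    then have "ennreal t < ennreal (u' * v')" using uv u' v' by (intro ennreal_lessI) (auto intro: mult_pos_pos)
    also have "\<dots> = ennreal u' * ennreal v'" using uv u' by (intro ennreal_mult') auto
    also have "\<dots> \<le> r * s" using u' v' by (intro mult_mono) auto
    finally show "ennreal t < r * s" .
  qed
next
  assume t: "ennreal t < r * s"
  have r0: "r \<noteq> 0" "s \<noteq> 0" using t by auto
  have ex: "\<exists>u v. 0 < u \<and> 0 < v \<and> t = u * v \<and> ennreal u < x \<and> ennreal v < y"
    if "0 < p" "ennreal p \<le> x" "0 < q" "ennreal q \<le> y" "t < p * q" for p q x y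
  proof -
    have "t / q < p" using that by (simp add: divide_less_eq)
    moreover have "0 < t / q" using assms that by simp
    ultimately obtain u where u: "t / q < u" "u < p" "0 < u"
      using dense[of "t / q" p] by (meson order_less_trans)
    have "t / u < q" using u that by (simp add: divide_less_eq mult.commute)
    then have "ennreal (t / u) < ennreal q" using that by (simp add: ennreal_lessI)
    moreover have "ennreal u < ennreal p" using that u by (simp add: ennreal_lessI)
    ultimately show ?thesis
      using u assms that by (intro exI[of _ u] exI[of _ "t / u"]) auto
  qed
  have pos: "\<exists>p. 0 < p \<and> ennreal p \<le> x" if "x \<noteq> 0" for x
  proof (cases x)
    case (real p)
    then show ?thesis using that by (intro exI[of _ p]) auto
  next
    case top
    then show ?thesis by (intro exI[of _ 1]) auto
  qed
  show "\<exists>u v. 0 < u \<and> 0 < v \<and> t = u * v \<and> ennreal u < r \<and> ennreal v < s"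
  proof (cases "r = top")
    case True
    obtain q where q: "0 < q" "ennreal q \<le> s" using pos r0 by blast
    \<comment> \<open>The factor \<open>t / q + 1\<close> is any real large enough: its product with
      \<open>q\<close> is \<open>t + q\<close>.\<close>
    then show ?thesis using ex[of "t / q + 1" r q s] True assms by (auto simp: field_simps)
  next
    case False
    then obtain p where p: "r = ennreal p" "0 < p" using r0
      by (cases r) (auto simp: less_le)
    show ?thesis
    proof (cases "s = top")
      case True
      then show ?thesis using ex[of p r "t / p + 1" s] p assms by (auto simp: field_simps)
    next
      case False
      then obtain q where q: "s = ennreal q" "0 < q" using r0
        by (cases s) (auto simp: less_le)
      have "t < p * q" using t p q by (simp add: ennreal_mult' [symmetric] ennreal_less_iff assms less_imp_le)
      then show ?thesis using ex p q by simp
    qed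
  qed
qed

text \<open>The element 0 keeps the set nonempty, hence directed, also for
  \<open>r = 0\<close>.\<close>

lemma ennreal_lub_less:
  "directed_in (UNIV :: ennreal set) (\<le>) (insert 0 {..<r})"
  "is_lub (UNIV :: ennreal set) (\<le>) (insert 0 {..<r}) r"
proof -
  show "directed_in (UNIV :: ennreal set) (\<le>) (insert 0 {..<r})"
    unfolding directed_in_def
  proof (intro conjI ballI)
    show "\<exists>z\<in>insert 0 {..<r}. x \<le> z \<and> y \<le> z"
      if "x \<in> insert 0 {..<r}" "y \<in> insert 0 {..<r}" for x y
      by (rule bexI[of _ "max x y"]) (use that in \<open>auto simp: max_def\<close>)
  qed auto
  show "is_lub (UNIV :: ennreal set) (\<le>) (insert 0 {..<r}) r"
    unfolding is_lub_def by (auto intro: dense_le)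
qed

section \<open>The way-below relation\<close>

locale cont_dcpo =
  fixes L :: "'a set" and le :: "'a \<Rightarrow> 'a \<Rightarrow> bool"
  assumes cont: "continuous_dcpo L le"
begin

abbreviation wb :: "'a \<Rightarrow> 'a \<Rightarrow> bool" where "wb \<equiv> way_below L le"

lemma reflp_le: "reflp_on L le"
  using cont by (simp add: continuous_dcpo_def dcpo_def poset_on_def)

lemma le_refl: "x \<in> L \<Longrightarrow> le x x"
  using reflp_le by (simp add: reflp_on_def)

lemma le_trans: "le x y \<Longrightarrow> le y z \<Longrightarrow> x \<in> L \<Longrightarrow> y \<in> L \<Longrightarrow> z \<in> L \<Longrightarrow> le x z"
  using cont unfolding continuous_dcpo_def dcpo_def poset_on_def transp_on_def by blast

lemma wbD: "wb x y \<Longrightarrow> x \<in> L" "wb x y \<Longrightarrow> y \<in> L"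
  by (auto simp: way_below_def)

lemma directed_wb: "x \<in> L \<Longrightarrow> directed_in L le {y. wb y x}"
  and lub_wb: "x \<in> L \<Longrightarrow> is_lub L le {y. wb y x} x"
  using cont by (auto simp: continuous_dcpo_def)

lemma wb_imp_le: "wb x y \<Longrightarrow> le x y"
  unfolding way_below_def
  using is_lub_directed_pair[OF reflp_le, of y y] le_refl by (metis insert_absorb2 singletonD)

lemma wb_le_trans: "wb x y \<Longrightarrow> le y z \<Longrightarrow> z \<in> L \<Longrightarrow> wb x z"
  unfolding way_below_def
proof (intro conjI allI impI; elim conjE)
  fix D s
  assume x: "x \<in> L" "y \<in> L" "le y z" "z \<in> L"
    and D: "\<forall>D s. directed_in L le D \<and> is_lub L le D s \<and> le y s \<longrightarrow> (\<exists>d\<in>D. le x d)"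
    and *: "directed_in L le D" "is_lub L le D s" "le z s"
  have "s \<in> L" using *(2) by (simp add: is_lub_def)
  then have "le y s" using le_trans[OF x(3) *(3)] x by blast
  then show "\<exists>d\<in>D. le x d" using D * by blast
qed auto

lemma le_wb_trans: "le x y \<Longrightarrow> wb y z \<Longrightarrow> x \<in> L \<Longrightarrow> wb x z"
  unfolding way_below_def
proof (intro conjI allI impI; elim conjE)
  fix D s
  assume x: "le x y" "x \<in> L" "y \<in> L"
    and D: "\<forall>D s. directed_in L le D \<and> is_lub L le D s \<and> le z s \<longrightarrow> (\<exists>d\<in>D. le y d)"
    and *: "directed_in L le D" "is_lub L le D s" "le z s"
  obtain d where "d \<in> D" "le y d" using D * by blast
  moreover have "D \<subseteq> L" using *(1) by (simp add: directed_in_def)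
  ultimately show "\<exists>d\<in>D. le x d" using le_trans x by blast
qed auto

lemma wb_trans: "wb x y \<Longrightarrow> wb y z \<Longrightarrow> wb x z"
  using wb_imp_le wbD wb_le_trans by blast

text \<open>The elements that lie way below \<open>y\<close> in two steps are directed with supremum
  \<open>y\<close>, since every \<open>z\<close> way below \<open>y\<close> is itself the supremum
  of the elements way below it. Testing \<open>wb x y\<close> on this set produces the
  interpolant.\<close>

lemma wb_interpolate_single:
  assumes "wb x y"
  obtains z where "wb x z" "wb z y"
proof -
  let ?D = "{w. \<exists>z. wb w z \<and> wb z y}"
  have y: "y \<in> L" using assms wbD by blast
  have "directed_in L le ?D"
    unfolding directed_in_def
  proof (intro conjI ballI)
    show "?D \<subseteq> L" using wbD by blast
    obtain z where "wb z y" using directed_wb[OF y] by (auto simp: directed_in_def)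
    moreover obtain w where "wb w z"
      using directed_wb[of z] wbD \<open>wb z y\<close> by (auto simp: directed_in_def)
    ultimately show "?D \<noteq> {}" by blast
    fix v w assume "v \<in> ?D" "w \<in> ?D"
    then obtain z1 z2 where z: "wb v z1" "wb z1 y" "wb w z2" "wb z2 y" by blast
    then obtain z where z': "wb z y" "le z1 z" "le z2 z"
      using directed_wb[OF y] unfolding directed_in_def by blast
    then have "z \<in> L" "wb v z" "wb w z" using wb_le_trans wbD z by blast+
    then obtain u where "wb u z" "le v u" "le w u"
      using directed_wb[of z] unfolding directed_in_def by blast
    then show "\<exists>u\<in>?D. le v u \<and> le w u" using z'(1) by blast
  qed
  moreover have "is_lub L le ?D y"
    unfolding is_lub_def
  proof (intro conjI ballI impI)
    show "y \<in> L" by fact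
    show "le w y" if "w \<in> ?D" for w using that wb_trans wb_imp_le by blast
    fix u assume u: "u \<in> L" "\<forall>w\<in>?D. le w u"
    have "le z u" if "wb z y" for z
      using lub_wb[of z] that u wbD unfolding is_lub_def by blast
    then show "le y u" using lub_wb[OF y] u(1) unfolding is_lub_def by blast
  qed
  ultimately obtain w where "w \<in> ?D" "le x w"
    using assms le_refl[OF y] unfolding way_below_def by blast
  then obtain z where "wb w z" "wb z y" by blast
  then show thesis using that le_wb_trans \<open>le x w\<close> assms wbD by blast
qed

lemma wb_interpolate:
  assumes "wb x y" "wb x' y"
  obtains z where "wb x z" "wb x' z" "wb z y"
proof -
  obtain z1 z2 where z: "wb x z1" "wb z1 y" "wb x' z2" "wb z2 y"
    using assms wb_interpolate_single by metis
  then obtain z where "wb z y" "le z1 z" "le z2 z"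
    using directed_wb[of y] wbD unfolding directed_in_def by blast
  then show thesis using that z wb_le_trans wbD by blast
qed

lemma ex_wb: "y \<in> L \<Longrightarrow> \<exists>x. wb x y"
  using directed_wb[of y] unfolding directed_in_def by blast

section \<open>The index order on strings\<close>

abbreviation pll :: "real \<times> 'a \<Rightarrow> real \<times> 'a \<Rightarrow> bool" where
  "pll \<equiv> rel_prod (<) wb"

abbreviation ll :: "(real \<times> 'a) multiset \<Rightarrow> (real \<times> 'a) multiset \<Rightarrow> bool" where
  "ll \<equiv> ll_plus L le"

lemma B_plus_empty [simp]: "{#} \<in> B_plus L"
  and B_plus_plus [simp]: "a + b \<in> B_plus L \<longleftrightarrow> a \<in> B_plus L \<and> b \<in> B_plus L"
  and B_plus_add [simp]: "add_mset p a \<in> B_plus L \<longleftrightarrow> 0 < fst p \<and> snd p \<in> L \<and> a \<in> B_plus L"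
  by (cases p; auto simp: B_plus_def)+

lemma ll_empty [simp]: "ll {#} b"
  and ll_empty_right [simp]: "ll a {#} \<longleftrightarrow> a = {#}"
  by (simp_all add: ll_plus_eq mset_emb_empty)

lemma ll_trans: "ll a b \<Longrightarrow> ll b c \<Longrightarrow> ll a c"
  unfolding ll_plus_eq
  by (erule (1) mset_emb_trans) (auto simp: rel_prod_sel intro: wb_trans)

lemma ll_plus_mono: "ll a b \<Longrightarrow> ll a' b' \<Longrightarrow> ll (a + a') (b + b')"
  unfolding ll_plus_eq by (rule mset_emb_plus)

lemma ll_plus_right:
  assumes "ll c (a + b)"
  obtains c1 c2 where "c = c1 + c2" "ll c1 a" "ll c2 b"
  using assms unfolding ll_plus_eq by (metis mset_emb_plus_right)

lemma pll_interpolate: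
  assumes "pll x y" "pll x' y" "0 < fst y"
  obtains z where "pll x z" "pll x' z" "pll z y" "0 < fst z" "snd z \<in> L"
proof -
  obtain w where w: "wb (snd x) w" "wb (snd x') w" "wb w (snd y)"
    using assms wb_interpolate[of "snd x" "snd y" "snd x'"] by (auto simp: rel_prod_sel)
  have "max (max (fst x) (fst x')) 0 < fst y" using assms by (auto simp: rel_prod_sel)
  then obtain r where "max (max (fst x) (fst x')) 0 < r" "r < fst y" using dense by blast
  then show thesis using that[of "(r, w)"] w wbD by (auto simp: rel_prod_sel)
qed

text \<open>The interpolation is done separately at each element \<open>y\<close> of
  \<open>c\<close>: the partners of \<open>y\<close> in \<open>a\<close> and in \<open>b\<close> are
  interpolated by a single \<open>z\<close>, and these \<open>z\<close> make up \<open>d\<close>. It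
  provides the directedness of the principal round ideals.\<close>

lemma ll_interpolate:
  assumes "c \<in> B_plus L" "ll a c" "ll b c"
  obtains d where "d \<in> B_plus L" "ll d c" "ll a d" "ll b d"
proof -
  have "\<exists>d\<in>B_plus L. ll d c \<and> ll a d \<and> ll b d"
    using assms unfolding ll_plus_eq
  proof (induction c arbitrary: a b)
    case empty
    then show ?case by (auto intro: bexI[of _ "{#}"])
  next
    case (add y c)
    have y: "0 < fst y" "snd y \<in> L" "c \<in> B_plus L" using add.prems(1) by auto
    obtain w where w: "wb w (snd y)" using ex_wb y(2) by blast
    \<comment> \<open>A substitute partner in case \<open>a\<close> or \<open>b\<close> leaves
      \<open>y\<close> unmatched; with it, matched and unmatched elements are treated alike.\<close>
    let ?w = "(fst y / 2, w)"
    have w': "pll ?w y" using w y by (simp add: rel_prod_sel)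
    have *: "\<exists>x a'. pll x y \<and> mset_emb pll a' c \<and>
        (\<forall>z d. pll x z \<longrightarrow> mset_emb pll a' d \<longrightarrow> mset_emb pll a (add_mset z d))"
      if "mset_emb pll a (add_mset y c)" for a
    proof -
      from that consider "mset_emb pll a c" |
        x a' where "a = add_mset x a'" "pll x y" "mset_emb pll a' c"
        unfolding mset_emb_add_right_iff[of pll a] by blast
      then show ?thesis
      proof cases
        case 1
        then show ?thesis using w' mset_emb_add_right[of pll a] by meson
      next
        case 2
        then show ?thesis using mset_emb_add[of pll x] by meson
      qed
    qed
    obtain x a' where a: "pll x y" "mset_emb pll a' c"
      "\<And>z d. pll x z \<Longrightarrow> mset_emb pll a' d \<Longrightarrow> mset_emb pll a (add_mset z d)"
      using *[OF add.prems(2)] by blast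
    obtain x' b' where b: "pll x' y" "mset_emb pll b' c"
      "\<And>z d. pll x' z \<Longrightarrow> mset_emb pll b' d \<Longrightarrow> mset_emb pll b (add_mset z d)"
      using *[OF add.prems(3)] by blast
    obtain z where z: "pll x z" "pll x' z" "pll z y" "0 < fst z" "snd z \<in> L"
      using pll_interpolate a(1) b(1) y(1) by metis
    obtain d where "d \<in> B_plus L" "mset_emb pll d c" "mset_emb pll a' d" "mset_emb pll b' d"
      using add.IH[OF y(3) a(2) b(2)] by blast
    then show ?case
      using a(3) b(3) z by (intro bexI[of _ "add_mset z d"]) (auto intro: mset_emb_add)
  qed
  then show thesis using that by blast
qed

text \<open>Scaling without the stripping done by \<open>scale_bag\<close>, so that it commutes with
  concatenation and composes for all factors; the two agree for positive factors on strings of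
  positive indices.\<close>

definition sc :: "real \<Rightarrow> (real \<times> 'a) multiset \<Rightarrow> (real \<times> 'a) multiset" where
  "sc k = image_mset (\<lambda>(s, x). (k * s, x))"

lemma sc_empty [simp]: "sc k {#} = {#}"
  and sc_eq_empty [simp]: "sc k a = {#} \<longleftrightarrow> a = {#}"
  and sc_plus [simp]: "sc k (a + b) = sc k a + sc k b"
  and sc_add [simp]: "sc k (add_mset (s, x) b) = add_mset (k * s, x) (sc k b)"
  and sc_one [simp]: "sc 1 a = a"
  by (auto simp: sc_def)

lemma sc_sc [simp]: "sc k (sc l a) = sc (k * l) a"
  by (auto simp: sc_def multiset.map_comp intro!: image_mset_cong)

lemma snd_sc: "snd ` set_mset (sc k a) = snd ` set_mset a"
  by (force simp: sc_def image_image)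

lemma sc_B_plus: "0 < k \<Longrightarrow> a \<in> B_plus L \<Longrightarrow> sc k a \<in> B_plus L"
  by (auto simp: sc_def B_plus_def)

lemma scale_bag_eq: "0 < k \<Longrightarrow> a \<in> B_plus L \<Longrightarrow> scale_bag k a = sc k a"
  unfolding scale_bag_def sc_def by (auto simp: filter_mset_eq_conv B_plus_def)

lemma scale_bag_zero: "scale_bag 0 a = {#}"
  unfolding scale_bag_def by (auto simp: filter_mset_eq_conv)

lemma sc_ll: "0 < k \<Longrightarrow> ll a b \<Longrightarrow> ll (sc k a) (sc k b)"
  unfolding ll_plus_eq sc_def by (erule mset_emb_image) (auto simp: rel_prod_sel)

lemma sc_ll_le:
  assumes "a \<in> B_plus L" "ll a b" "k \<le> 1"
  shows "ll (sc k a) b"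
proof -
  have *: "k * r < s" if "0 < r" "r < s" for r s :: real
    using mult_right_mono[OF assms(3), of r] that by linarith
  have "mset_emb pll (image_mset (\<lambda>(s, x). (k * s, x)) a) (image_mset id b)"
    using assms(2) unfolding ll_plus_eq
  proof (rule mset_emb_image)
    fix p q :: "real \<times> 'a" assume p: "p \<in># a" "pll p q"
    then have "0 < fst p" using assms(1) by (auto simp: B_plus_def)
    then show "pll (case p of (s, x) \<Rightarrow> (k * s, x)) (id q)"
      using p(2) * by (simp add: rel_prod_sel case_prod_beta)
  qed
  then show ?thesis unfolding ll_plus_eq sc_def by simp
qed

text \<open>An index \<open>r\<close> below \<open>s\<close> may grow by any factor below
  \<open>s / r\<close>, which exceeds 1; finitely many such bounds have a minimum above 1. The
  induction therefore speaks of all factors up to a threshold \<open>k0\<close>, not of a single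
  factor.\<close>

lemma sc_ll_up:
  assumes "a \<in> B_plus L" "ll a b"
  obtains k where "1 < k" "ll (sc k a) b"
proof -
  have "\<exists>k0>1. \<forall>k. 1 < k \<longrightarrow> k < k0 \<longrightarrow> mset_emb pll (sc k a) b"
    using assms(2,1) unfolding ll_plus_eq
  proof (induction rule: mset_emb.induct)
    case (mset_emb_empty b)
    then show ?case by (auto intro: mset_emb.mset_emb_empty exI[of _ 2])
  next
    case (mset_emb_add p q a b)
    then obtain k0 where k0: "1 < k0" "\<And>k. 1 < k \<Longrightarrow> k < k0 \<Longrightarrow> mset_emb pll (sc k a) b"
      by auto
    obtain r x s y where pq: "p = (r, x)" "q = (s, y)" by fastforce
    have rs: "0 < r" "r < s" "wb x y" using mset_emb_add.hyps(1) mset_emb_add.prems pq by auto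
    have "mset_emb pll (sc k (add_mset p a)) (add_mset q b)"
      if "1 < k" "k < min k0 (s / r)" for k
    proof -
      have "k * r < s" using that rs(1) by (simp add: pos_less_divide_eq)
      then show ?thesis using that k0(2) rs(3) by (auto simp: pq intro: mset_emb.mset_emb_add)
    qed
    moreover have "1 < min k0 (s / r)" using k0(1) rs by (simp add: pos_less_divide_eq)
    ultimately show ?case by blast
  qed
  then show thesis using that dense unfolding ll_plus_eq by blast
qed


section \<open>Round ideals and their operations\<close>

lemma IV_I:
  assumes "R \<subseteq> B_plus L" "R \<noteq> {}"
    "\<And>a b. a \<in> B_plus L \<Longrightarrow> b \<in> R \<Longrightarrow> ll a b \<Longrightarrow> a \<in> R"
    "\<And>a b. a \<in> R \<Longrightarrow> b \<in> R \<Longrightarrow> \<exists>c\<in>R. ll a c \<and> ll b c"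
  shows "R \<in> IV L le"
  using assms unfolding IV_def by blast

lemma IV_B_plus: "R \<in> IV L le \<Longrightarrow> a \<in> R \<Longrightarrow> a \<in> B_plus L"
  and IV_down: "R \<in> IV L le \<Longrightarrow> b \<in> R \<Longrightarrow> ll a b \<Longrightarrow> a \<in> B_plus L \<Longrightarrow> a \<in> R"
  and IV_ne: "R \<in> IV L le \<Longrightarrow> R \<noteq> {}"
  and IV_dir: "R \<in> IV L le \<Longrightarrow> a \<in> R \<Longrightarrow> b \<in> R \<Longrightarrow> \<exists>c\<in>R. ll a c \<and> ll b c"
  unfolding IV_def by blast+

lemma IV_empty_mem: "R \<in> IV L le \<Longrightarrow> {#} \<in> R"
  using IV_ne IV_down B_plus_empty ll_empty by blast

lemma IV_round: "R \<in> IV L le \<Longrightarrow> a \<in> R \<Longrightarrow> \<exists>b\<in>R. ll a b"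
  using IV_dir by blast

lemma IV_sc_le:
  assumes "R \<in> IV L le" "a \<in> R" "0 < k" "k \<le> 1"
  shows "sc k a \<in> R"
proof -
  obtain b where "b \<in> R" "ll a b" using IV_round assms by blast
  then show ?thesis using IV_down[OF assms(1)] sc_ll_le IV_B_plus[OF assms(1)] sc_B_plus assms
    by metis
qed

text \<open>Roundness leaves room for a factor above 1. Dividing by this factor later yields the
  strict inequality \<open>t < r\<close> in the description of scalar multiples.\<close>

lemma IV_sc_up:
  assumes "R \<in> IV L le" "a \<in> R"
  obtains k where "1 < k" "sc k a \<in> R"
proof -
  obtain b where b: "b \<in> R" "ll a b" using IV_round assms by blast
  obtain k where "1 < k" "ll (sc k a) b" using sc_ll_up[OF _ b(2)] IV_B_plus assms by metis
  moreover have "sc k a \<in> B_plus L"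
    using sc_B_plus[of k a] IV_B_plus assms \<open>1 < k\<close> by auto
  ultimately show thesis using that IV_down[OF assms(1) b(1)] by blast
qed

lemma IV_zero_IV: "IV_zero \<in> IV L le"
  unfolding IV_zero_def by (rule IV_I) auto

lemma DDown_single: "DDown L le {b} = {c \<in> B_plus L. ll c b}"
  by (auto simp: DDown_def)

lemma DDown_IV:
  assumes "b \<in> B_plus L" shows "DDown L le {b} \<in> IV L le"
  unfolding DDown_single
proof (rule IV_I)
  show "{c \<in> B_plus L. ll c b} \<noteq> {}" using B_plus_empty ll_empty by blast
  show "\<exists>c\<in>{c \<in> B_plus L. ll c b}. ll x c \<and> ll y c"
    if "x \<in> {c \<in> B_plus L. ll c b}" "y \<in> {c \<in> B_plus L. ll c b}" for x y
    using that ll_interpolate[OF assms, of x y] by blast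
qed (auto intro: ll_trans)

section \<open>Addition of round ideals\<close>

lemma IV_add_eq:
  assumes R: "R \<in> IV L le" and S: "S \<in> IV L le"
  shows "IV_add L le R S = {a + b | a b. a \<in> R \<and> b \<in> S}"
proof (intro equalityI subsetI)
  fix c assume "c \<in> IV_add L le R S"
  then obtain a b where ab: "c \<in> B_plus L" "a \<in> R" "b \<in> S" "ll c (a + b)"
    unfolding IV_add_def DDown_def by blast
  then obtain c1 c2 where "c = c1 + c2" "ll c1 a" "ll c2 b" using ll_plus_right by metis
  then show "c \<in> {a + b | a b. a \<in> R \<and> b \<in> S}"
    using ab IV_down[OF R, of a c1] IV_down[OF S, of b c2] by auto
next
  fix c assume "c \<in> {a + b | a b. a \<in> R \<and> b \<in> S}"
  then obtain a b where ab: "c = a + b" "a \<in> R" "b \<in> S" by blast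
  obtain a' b' where "a' \<in> R" "ll a a'" "b' \<in> S" "ll b b'"
    using ab IV_round R S by metis
  then have "ll c (a' + b')" "a' + b' \<in> {a + b | a b. a \<in> R \<and> b \<in> S}" "c \<in> B_plus L"
    using ab ll_plus_mono IV_B_plus[OF R] IV_B_plus[OF S] by auto
  then show "c \<in> IV_add L le R S" unfolding IV_add_def DDown_def by blast
qed

lemma IV_add_IV:
  assumes R: "R \<in> IV L le" and S: "S \<in> IV L le"
  shows "IV_add L le R S \<in> IV L le"
proof (rule IV_I)
  show "IV_add L le R S \<subseteq> B_plus L" by (auto simp: IV_add_def DDown_def)
  show "IV_add L le R S \<noteq> {}" using IV_ne[OF R] IV_ne[OF S] by (auto simp: IV_add_eq[OF R S])
  show "a \<in> IV_add L le R S" if "a \<in> B_plus L" "b \<in> IV_add L le R S" "ll a b" for a b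
    using that unfolding IV_add_def DDown_def by (auto intro: ll_trans)
  fix a b assume "a \<in> IV_add L le R S" "b \<in> IV_add L le R S"
  then obtain a1 a2 b1 b2 where *: "a = a1 + a2" "b = b1 + b2" "a1 \<in> R" "b1 \<in> R" "a2 \<in> S" "b2 \<in> S"
    by (auto simp: IV_add_eq[OF R S])
  obtain c1 where "c1 \<in> R" "ll a1 c1" "ll b1 c1" using IV_dir[OF R] * by blast
  moreover obtain c2 where "c2 \<in> S" "ll a2 c2" "ll b2 c2" using IV_dir[OF S] * by blast
  ultimately show "\<exists>c\<in>IV_add L le R S. ll a c \<and> ll b c"
    using * by (intro bexI[of _ "c1 + c2"]) (auto simp: IV_add_eq[OF R S] intro: ll_plus_mono)
qed

lemma IV_add_mono:
  "R \<in> IV L le \<Longrightarrow> S \<in> IV L le \<Longrightarrow> R' \<in> IV L le \<Longrightarrow> S' \<in> IV L le \<Longrightarrow> R \<subseteq> R' \<Longrightarrow> S \<subseteq> S' \<Longrightarrow>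
     IV_add L le R S \<subseteq> IV_add L le R' S'"
  by (auto simp: IV_add_eq)

lemma IV_add_comm: "R \<in> IV L le \<Longrightarrow> S \<in> IV L le \<Longrightarrow> IV_add L le R S = IV_add L le S R"
  by (auto simp: IV_add_eq) (use add.commute in blast)+

lemma IV_add_memI: "R \<in> IV L le \<Longrightarrow> S \<in> IV L le \<Longrightarrow> a \<in> R \<Longrightarrow> b \<in> S \<Longrightarrow> a + b \<in> IV_add L le R S"
  by (auto simp: IV_add_eq)

lemma IV_add_memE:
  assumes "R \<in> IV L le" "S \<in> IV L le" "c \<in> IV_add L le R S"
  obtains a b where "c = a + b" "a \<in> R" "b \<in> S"
  using assms by (auto simp: IV_add_eq)

lemma IV_add_assoc:
  assumes R: "R \<in> IV L le" and S: "S \<in> IV L le" and T: "T \<in> IV L le"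
  shows "IV_add L le (IV_add L le R S) T = IV_add L le R (IV_add L le S T)"
proof (intro equalityI subsetI)
  fix c assume "c \<in> IV_add L le (IV_add L le R S) T"
  then obtain d e where de: "c = d + e" "d \<in> IV_add L le R S" "e \<in> T"
    using IV_add_memE[OF IV_add_IV[OF R S] T] by metis
  obtain a b where ab: "d = a + b" "a \<in> R" "b \<in> S" using IV_add_memE[OF R S de(2)] by metis
  have "a + (b + e) \<in> IV_add L le R (IV_add L le S T)"
    by (intro IV_add_memI IV_add_IV R S T ab de)
  then show "c \<in> IV_add L le R (IV_add L le S T)" by (simp add: de ab add.assoc)
next
  fix c assume "c \<in> IV_add L le R (IV_add L le S T)"
  then obtain d e where de: "c = d + e" "d \<in> R" "e \<in> IV_add L le S T"
    using IV_add_memE[OF R IV_add_IV[OF S T]] by metis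
  obtain a b where ab: "e = a + b" "a \<in> S" "b \<in> T" using IV_add_memE[OF S T de(3)] by metis
  have "(d + a) + b \<in> IV_add L le (IV_add L le R S) T"
    by (intro IV_add_memI IV_add_IV R S T ab de)
  then show "c \<in> IV_add L le (IV_add L le R S) T" by (simp add: de ab add.assoc)
qed

lemma IV_zero_add: "R \<in> IV L le \<Longrightarrow> IV_add L le IV_zero R = R"
  by (simp add: IV_add_eq IV_zero_IV) (simp add: IV_zero_def)

section \<open>Scalar multiplication of round ideals\<close>

lemma IV_scale_real_zero: "R \<in> IV L le \<Longrightarrow> IV_scale_real L le 0 R = {{#}}"
  using IV_ne unfolding IV_scale_real_def DDown_def by (auto simp: scale_bag_zero)

lemma IV_scale_real_eq:
  assumes R: "R \<in> IV L le" and r: "0 \<le> r"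
  shows "IV_scale_real L le r R = insert {#} {sc t b | t b. 0 < t \<and> t < r \<and> b \<in> R}"
proof (cases "r = 0")
  case True
  then have empty: "{sc t b | t b. 0 < t \<and> t < r \<and> b \<in> R} = {}" by auto
  show ?thesis unfolding empty using IV_scale_real_zero[OF R] True by simp
next
  case False
  with r have r: "0 < r" by simp
  have *: "IV_scale_real L le r R = {c \<in> B_plus L. \<exists>b\<in>R. ll c (sc r b)}"
    unfolding IV_scale_real_def DDown_def using scale_bag_eq[OF r] IV_B_plus[OF R] by auto
  show ?thesis
  proof (intro equalityI subsetI)
    fix c assume "c \<in> IV_scale_real L le r R"
    then obtain b where b: "c \<in> B_plus L" "b \<in> R" "ll c (sc r b)" unfolding * by blast
    then have "ll (sc (1 / r) c) b" using sc_ll[of "1 / r" c "sc r b"] r by simp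
    then have "sc (1 / r) c \<in> R" using IV_down[OF R b(2)] sc_B_plus[of "1 / r" c] b(1) r by simp
    \<comment> \<open>The factor \<open>k\<close> taken from roundness lowers the scalar from
      \<open>r\<close> to \<open>r / k\<close>, which is strictly below \<open>r\<close> as
      required.\<close>
    then obtain k where k: "1 < k" "sc k (sc (1 / r) c) \<in> R" using IV_sc_up[OF R] by blast
    have "c = sc (r / k) (sc k (sc (1 / r) c))" using k r by simp
    moreover have "0 < r / k" "r / k < r" using k r by (auto simp: divide_less_eq)
    ultimately show "c \<in> insert {#} {sc t b | t b. 0 < t \<and> t < r \<and> b \<in> R}" using k(2) by blast
  next
    fix c assume "c \<in> insert {#} {sc t b | t b. 0 < t \<and> t < r \<and> b \<in> R}"
    then consider "c = {#}" | t b where "c = sc t b" "0 < t" "t < r" "b \<in> R" by blast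
    then show "c \<in> IV_scale_real L le r R"
    proof cases
      case 1
      then show ?thesis using IV_ne[OF R] unfolding * by auto
    next
      case 2
      \<comment> \<open>Rewriting \<open>t b\<close> as \<open>r ((t / r) b)\<close> moves the gap
        between \<open>t\<close> and \<open>r\<close> into \<open>R\<close>, where roundness turns
        it into a string strictly above.\<close>
      have "sc (t / r) b \<in> R" using IV_sc_le[OF R 2(4)] 2 r by (simp add: divide_le_eq)
      then obtain b' where "b' \<in> R" "ll (sc (t / r) b) b'" using IV_round R by blast
      then have "ll (sc r (sc (t / r) b)) (sc r b')" using sc_ll r by blast
      then have "ll c (sc r b')" using 2 r by simp
      then show ?thesis unfolding * using \<open>b' \<in> R\<close> 2 sc_B_plus IV_B_plus[OF R] by auto
    qed
  qed
qed

lemma IV_scale_eq: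
  assumes R: "R \<in> IV L le"
  shows "IV_scale L le r R = insert {#} {sc t b | t b. 0 < t \<and> ennreal t < r \<and> b \<in> R}"
proof (cases "r = \<infinity>")
  case True
  have "(\<Union>s\<in>{0..}. insert {#} {sc t b | t b. 0 < t \<and> t < s \<and> b \<in> R}) =
      insert {#} {sc t b | t b. 0 < t \<and> b \<in> R}"
  proof (intro equalityI subsetI)
    fix c assume "c \<in> insert {#} {sc t b | t b. 0 < t \<and> b \<in> R}"
    then consider "c = {#}" | t b where "c = sc t b" "0 < t" "b \<in> R" by blast
    then show "c \<in> (\<Union>s\<in>{0..}. insert {#} {sc t b | t b. 0 < t \<and> t < s \<and> b \<in> R})"
    proof cases
      case 2
      then have "c \<in> {sc t b | t b. 0 < t \<and> t < (t + 1) \<and> b \<in> R}" by auto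
      moreover from 2 have "t < t + 1" by simp
      ultimately show ?thesis using 2 by (intro UN_I[of "t + 1"]) (simp, blast)
    qed auto
  qed auto
  then show ?thesis using True by (simp add: IV_scale_def IV_scale_real_eq[OF R])
next
  case False
  then obtain r' where r': "r = ennreal r'" "0 \<le> r'" by (cases r) auto
  then have "ennreal t < r \<longleftrightarrow> t < r'" if "0 < t" for t
    using that by (simp add: ennreal_less_iff)
  then show ?thesis
    using False r' by (auto simp: IV_scale_def IV_scale_real_eq[OF R])
qed

lemma IV_scale_memI: "R \<in> IV L le \<Longrightarrow> b \<in> R \<Longrightarrow> 0 < t \<Longrightarrow> ennreal t < r \<Longrightarrow> sc t b \<in> IV_scale L le r R"
  and IV_scale_empty_mem: "R \<in> IV L le \<Longrightarrow> {#} \<in> IV_scale L le r R"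
  by (auto simp: IV_scale_eq)

lemma IV_scale_memE:
  assumes "R \<in> IV L le" "c \<in> IV_scale L le r R"
  obtains "c = {#}" | t b where "c = sc t b" "0 < t" "ennreal t < r" "b \<in> R"
  using assms by (auto simp: IV_scale_eq)

lemma IV_scale_IV:
  assumes R: "R \<in> IV L le"
  shows "IV_scale L le r R \<in> IV L le"
proof (rule IV_I)
  show "IV_scale L le r R \<subseteq> B_plus L"
    using IV_B_plus[OF R] by (auto simp: IV_scale_eq[OF R] sc_B_plus)
  show "IV_scale L le r R \<noteq> {}" using IV_scale_empty_mem[OF R] by blast
  show "a \<in> IV_scale L le r R" if "a \<in> B_plus L" "b \<in> IV_scale L le r R" "ll a b" for a b
    using R that(2)
  proof (cases rule: IV_scale_memE)
    case 1
    then show ?thesis using that by simp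
  next
    case (2 t c)
    then have "ll (sc (1 / t) a) c" using sc_ll[of "1 / t" a b] that(3) by simp
    then have "sc (1 / t) a \<in> R" using IV_down[OF R 2(4)] sc_B_plus[of "1 / t" a] that 2 by simp
    then have "sc t (sc (1 / t) a) \<in> IV_scale L le r R" using IV_scale_memI[OF R] 2 by blast
    then show ?thesis using 2 by simp
  qed
  \<comment> \<open>Strings with different factors are brought to the larger factor
    \<open>t'\<close>: \<open>t a\<close> equals \<open>t' ((t / t') a)\<close>, and
    \<open>(t / t') a\<close> still lies in \<open>R\<close>. Directedness of \<open>R\<close> then
    applies before scaling.\<close>
  have *: "\<exists>c\<in>IV_scale L le r R. ll (sc t a) c \<and> ll (sc t' a') c"
    if "0 < t" "t \<le> t'" "ennreal t' < r" "a \<in> R" "a' \<in> R" for t t' a a'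
  proof -
    have "sc (t / t') a \<in> R" using IV_sc_le[OF R that(4)] that by simp
    then obtain d where d: "d \<in> R" "ll (sc (t / t') a) d" "ll a' d" using IV_dir[OF R _ \<open>a' \<in> R\<close>] by metis
    then have "ll (sc t' (sc (t / t') a)) (sc t' d)" "ll (sc t' a') (sc t' d)"
      using sc_ll[of t'] \<open>0 < t\<close> \<open>t \<le> t'\<close> by (metis order_less_le_trans)+
    moreover have "sc t' d \<in> IV_scale L le r R" using IV_scale_memI[OF R d(1)] \<open>0 < t\<close> \<open>t \<le> t'\<close> \<open>ennreal t' < r\<close> by simp
    moreover have "sc t' (sc (t / t') a) = sc t a" using \<open>0 < t\<close> \<open>t \<le> t'\<close> by simp
    ultimately show ?thesis by metis
  qed
  show "\<exists>c\<in>IV_scale L le r R. ll a c \<and> ll b c"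
    if "a \<in> IV_scale L le r R" "b \<in> IV_scale L le r R" for a b
    using R that(1)
  proof (cases rule: IV_scale_memE)
    case 1
    from R that(2) show ?thesis
    proof (cases rule: IV_scale_memE)
      case 1
      then show ?thesis using \<open>a = {#}\<close> IV_scale_empty_mem[OF R] by auto
    next
      case (2 t b')
      then show ?thesis using 1 *[of t t b' b'] by auto
    qed
  next
    case a: (2 t a')
    from R that(2) show ?thesis
    proof (cases rule: IV_scale_memE)
      case 1
      then show ?thesis using a *[of t t a' a'] by auto
    next
      case b: (2 t' b')
      show ?thesis
        using a b *[of t t' a' b'] *[of t' t b' a'] by (cases "t \<le> t'") auto
    qed
  qed
qed

lemma IV_scale_mono:
  assumes "R \<in> IV L le" "S \<in> IV L le" "r \<le> s" "R \<subseteq> S"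
  shows "IV_scale L le r R \<subseteq> IV_scale L le s S"
  unfolding IV_scale_eq[OF assms(1)] IV_scale_eq[OF assms(2)]
  using order_less_le_trans[OF _ assms(3)] assms(4) by blast

lemma IV_one_scale:
  assumes R: "R \<in> IV L le" shows "IV_scale L le 1 R = R"
proof (intro equalityI subsetI)
  fix c assume "c \<in> IV_scale L le 1 R"
  with R show "c \<in> R"
  proof (cases rule: IV_scale_memE)
    case 1
    then show ?thesis using IV_empty_mem[OF R] by simp
  next
    case (2 t b)
    then show ?thesis using IV_sc_le[OF R, of b t] by (simp add: ennreal_less_one_iff)
  qed
next
  fix c assume "c \<in> R"
  then obtain k where k: "1 < k" "sc k c \<in> R" using IV_sc_up[OF R] by blast
  then have "sc (1 / k) (sc k c) \<in> IV_scale L le 1 R"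
    by (intro IV_scale_memI[OF R]) (auto simp: ennreal_less_one_iff)
  then show "c \<in> IV_scale L le 1 R" using k by simp
qed

lemma IV_zero_scale: "R \<in> IV L le \<Longrightarrow> IV_scale L le 0 R = IV_zero"
  by (auto simp: IV_scale_eq IV_zero_def)

lemma IV_mult_scale:
  assumes R: "R \<in> IV L le"
  shows "IV_scale L le (r * s) R = IV_scale L le r (IV_scale L le s R)"
proof (intro equalityI subsetI)
  fix c assume "c \<in> IV_scale L le (r * s) R"
  with R show "c \<in> IV_scale L le r (IV_scale L le s R)"
  proof (cases rule: IV_scale_memE)
    case 1
    then show ?thesis using IV_scale_empty_mem IV_scale_IV R by blast
  next
    case (2 t b)
    then obtain u v where "0 < u" "0 < v" "t = u * v" "ennreal u < r" "ennreal v < s"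
      using ennreal_less_mult_iff by blast
    then show ?thesis
      using IV_scale_memI[OF IV_scale_IV[OF R] IV_scale_memI[OF R 2(4)]] 2 by (metis sc_sc)
  qed
next
  fix c assume "c \<in> IV_scale L le r (IV_scale L le s R)"
  with IV_scale_IV[OF R] show "c \<in> IV_scale L le (r * s) R"
  proof (cases rule: IV_scale_memE)
    case 1
    then show ?thesis using IV_scale_empty_mem R by blast
  next
    case (2 t b)
    from R 2(4) show ?thesis
    proof (cases rule: IV_scale_memE)
      case 1
      then show ?thesis using IV_scale_empty_mem R 2 by simp
    next
      case b: (2 t' b')
      have "ennreal (t * t') < r * s"
        using ennreal_less_mult_iff[of "t * t'" r s] 2 b by auto
      then show ?thesis using IV_scale_memI[OF R b(4), of "t * t'"] 2 b by auto
    qed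
  qed
qed

lemma IV_scale_add:
  assumes R: "R \<in> IV L le" and S: "S \<in> IV L le"
  shows "IV_scale L le r (IV_add L le R S) = IV_add L le (IV_scale L le r R) (IV_scale L le r S)"
    (is "?l = ?r")
proof (intro equalityI subsetI)
  have RS: "IV_add L le R S \<in> IV L le" using IV_add_IV R S by blast
  have r: "?r = {a + b | a b. a \<in> IV_scale L le r R \<and> b \<in> IV_scale L le r S}"
    using IV_add_eq IV_scale_IV R S by blast
  show "c \<in> ?r" if "c \<in> ?l" for c
    using RS that
  proof (cases rule: IV_scale_memE)
    case 1
    then show ?thesis using IV_scale_empty_mem R S unfolding r by force
  next
    case (2 t b)
    then obtain b1 b2 where "b = b1 + b2" "b1 \<in> R" "b2 \<in> S" using IV_add_eq[OF R S] by auto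
    then have "c = sc t b1 + sc t b2" "sc t b1 \<in> IV_scale L le r R" "sc t b2 \<in> IV_scale L le r S"
      using 2 IV_scale_memI R S by auto
    then show ?thesis unfolding r by blast
  qed
  \<comment> \<open>The factor of a member of \<open>r T\<close> may be raised to any value that is
    still below \<open>r\<close>, so members of \<open>r R\<close> and \<open>r S\<close> can be
    written with one common factor, the maximum of their two. The empty string can take any factor,
    but a positive one below \<open>r\<close> exists only for nonzero \<open>r\<close>.\<close>
  have norm: "\<exists>u b. 0 < u \<and> ennreal u < r \<and> b \<in> T \<and> (\<forall>t\<ge>u. ennreal t < r \<longrightarrow> (\<exists>b'\<in>T. a = sc t b'))"
    if "T \<in> IV L le" "a \<in> IV_scale L le r T" "r \<noteq> 0" for a T
    using that(1,2)
  proof (cases rule: IV_scale_memE)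
    case 1
    obtain u where "0 < u" "ennreal u < r"
      using ennreal_ex_pos_less[OF \<open>r \<noteq> 0\<close>] by metis
    then show ?thesis using 1 IV_empty_mem[OF that(1)] by force
  next
    case (2 u b)
    have "\<exists>b'\<in>T. a = sc t b'" if "t \<ge> u" for t
      using IV_sc_le[OF \<open>T \<in> IV L le\<close> 2(4), of "u / t"] 2 that
      by (intro bexI[of _ "sc (u / t) b"]) auto
    then show ?thesis using 2 by blast
  qed
  show "c \<in> ?l" if "c \<in> ?r" for c
  proof (cases "r = 0")
    case True
    then show ?thesis using that R S RS
      by (simp add: IV_zero_scale IV_zero_add IV_zero_IV)
  next
    case False
    obtain a b where ab: "c = a + b" "a \<in> IV_scale L le r R" "b \<in> IV_scale L le r S"
      using \<open>c \<in> ?r\<close> unfolding r by blast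
    obtain u where u: "0 < u" "ennreal u < r"
      "\<And>t. t \<ge> u \<Longrightarrow> ennreal t < r \<Longrightarrow> \<exists>b'\<in>R. a = sc t b'"
      using norm[OF R ab(2) False] by blast
    obtain v where v: "0 < v" "ennreal v < r"
      "\<And>t. t \<ge> v \<Longrightarrow> ennreal t < r \<Longrightarrow> \<exists>b'\<in>S. b = sc t b'"
      using norm[OF S ab(3) False] by blast
    let ?t = "max u v"
    have t: "0 < ?t" "ennreal ?t < r" using u v by (auto simp: max_def)
    obtain a' b' where "a' \<in> R" "a = sc ?t a'" "b' \<in> S" "b = sc ?t b'"
      using u(3)[of ?t] v(3)[of ?t] t by auto
    then have "a' + b' \<in> IV_add L le R S" "c = sc ?t (a' + b')"
      using IV_add_eq[OF R S] ab by auto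
    then show ?thesis using IV_scale_memI[OF RS _ t] by blast
  qed
qed

section \<open>Sums and multiples of principal round ideals\<close>

lemma DDown_plus:
  assumes "a \<in> B_plus L" "b \<in> B_plus L"
  shows "DDown L le {a + b} = IV_add L le (DDown L le {a}) (DDown L le {b})"
proof (intro equalityI subsetI)
  fix c assume c: "c \<in> DDown L le {a + b}"
  then have "ll c (a + b)" by (simp add: DDown_single)
  then obtain c1 c2 where "c = c1 + c2" "ll c1 a" "ll c2 b" by (rule ll_plus_right)
  then show "c \<in> IV_add L le (DDown L le {a}) (DDown L le {b})"
    using c IV_add_memI[OF DDown_IV[OF assms(1)] DDown_IV[OF assms(2)], of c1 c2]
    by (simp add: DDown_single)
next
  fix c assume "c \<in> IV_add L le (DDown L le {a}) (DDown L le {b})"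
  with DDown_IV[OF assms(1)] DDown_IV[OF assms(2)] show "c \<in> DDown L le {a + b}"
    by (cases rule: IV_add_memE) (auto simp: DDown_single intro: ll_plus_mono)
qed

lemma DDown_sc:
  assumes b: "b \<in> B_plus L" and r: "0 < r"
  shows "DDown L le {sc r b} = IV_scale L le (ennreal r) (DDown L le {b})" (is "?l = ?r")
proof (intro equalityI subsetI)
  have D: "DDown L le {b} \<in> IV L le" "DDown L le {sc r b} \<in> IV L le"
    using DDown_IV b sc_B_plus r by auto
  show "c \<in> ?r" if "c \<in> ?l" for c
  proof -
    \<comment> \<open>As for general scalar multiples, \<open>k\<close> makes the factor
      \<open>r / k\<close> strictly smaller than \<open>r\<close>.\<close>
    obtain k where k: "1 < k" "sc k c \<in> ?l" using IV_sc_up[OF D(2) \<open>c \<in> ?l\<close>] by metis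
    have "ll (sc (1 / r) (sc k c)) b"
      using sc_ll[of "1 / r" "sc k c" "sc r b"] k r by (simp add: DDown_single)
    moreover have "c \<in> B_plus L" using that by (simp add: DDown_single)
    ultimately have "sc (k / r) c \<in> DDown L le {b}"
      using sc_B_plus[of "k / r" c] k r by (simp add: DDown_single)
    then have "sc (r / k) (sc (k / r) c) \<in> ?r"
      by (rule IV_scale_memI[OF D(1)]) (use k r in \<open>auto simp: ennreal_less_iff divide_less_eq\<close>)
    then show ?thesis using k r by simp
  qed
  show "c \<in> ?l" if "c \<in> ?r" for c
    using D(1) that
  proof (cases rule: IV_scale_memE)
    case 1
    then show ?thesis using IV_empty_mem D(2) by blast
  next
    case (2 t a)
    then have "sc r a \<in> ?l"
      using sc_ll sc_B_plus r by (auto simp: DDown_single)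
    then have "sc (t / r) (sc r a) \<in> ?l"
      by (rule IV_sc_le[OF D(2)]) (use 2 r in \<open>auto simp: ennreal_less_iff\<close>)
    then show ?thesis using 2 r by simp
  qed
qed

lemma eta_scale:
  assumes "0 < r" "x \<in> L"
  shows "IV_scale L le (ennreal r) (eta L le x) = DDown L le {{#(r, x)#}}"
  using DDown_sc[of "{#(1, x)#}" r] assms by (simp add: eta_def)

lemma eta_IV: "x \<in> L \<Longrightarrow> eta L le x \<in> IV L le"
  unfolding eta_def by (simp add: DDown_IV)


section \<open>The consistent part\<close>

definition bnd :: "(real \<times> 'a) multiset \<Rightarrow> bool" where
  "bnd b \<longleftrightarrow> b = {#} \<or> (\<exists>u\<in>L. \<forall>x\<in>snd ` set_mset b. le x u)"

lemma bnd_empty [simp]: "bnd {#}"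
  by (simp add: bnd_def)

lemma bnd_sc [simp]: "bnd (sc k b) \<longleftrightarrow> bnd b"
  by (simp add: bnd_def snd_sc)

text \<open>A bound for the elements of \<open>c\<close> also bounds those of \<open>a\<close> and
  \<open>b\<close>. The concatenation need not lie below \<open>c\<close>, yet it stays bounded;
  this keeps sums of consistent pairs inside the closure.\<close>

lemma bnd_ll_plus:
  assumes "ll a c" "ll b c" "bnd c"
  shows "bnd (a + b)"
proof (cases "c = {#}")
  case True
  then show ?thesis using assms by simp
next
  case False
  then obtain u where u: "u \<in> L" "\<And>p. p \<in># c \<Longrightarrow> le (snd p) u"
    using assms(3) unfolding bnd_def by auto
  have *: "\<forall>p\<in>#d. le (snd p) u" if "ll d c" for d
    using that u(2) unfolding ll_plus_eq
  proof (induction rule: mset_emb.induct)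
    case (mset_emb_add p q a b)
    then have "wb (snd p) (snd q)" "le (snd q) u" by (auto simp: rel_prod_sel)
    then have "le (snd p) u" using u(1) wb_le_trans wb_imp_le by blast
    then show ?case using mset_emb_add by auto
  qed auto
  show ?thesis
    unfolding bnd_def using *[OF assms(1)] *[OF assms(2)] u(1)
    by (intro disjI2 bexI[of _ u]) auto
qed

lemma bnd_ll: "ll a c \<Longrightarrow> bnd c \<Longrightarrow> bnd a"
  using bnd_ll_plus[of a c "{#}"] by simp

lemma bounded_basis_eq: "bounded_basis L le = {DDown L le {b} | b. b \<in> B_plus L \<and> bnd b}"
proof -
  have "DDown L le {{#}} = {{#}}" by (auto simp: DDown_single)
  then show ?thesis
    unfolding bounded_basis_def bounded_strings_def bnd_def
    by (auto simp: B_plus_empty)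
qed

section \<open>Directed unions and the Scott closure\<close>

lemma IV_Union:
  assumes "directed_in A (\<subseteq>) D" "A \<subseteq> IV L le"
  shows "\<Union>D \<in> IV L le"
proof (rule IV_I)
  have D: "D \<subseteq> IV L le" "D \<noteq> {}" using assms by (auto simp: directed_in_def)
  show "\<Union>D \<subseteq> B_plus L" using D IV_B_plus by blast
  show "\<Union>D \<noteq> {}" using D IV_empty_mem by blast
  show "a \<in> \<Union>D" if "a \<in> B_plus L" "b \<in> \<Union>D" "ll a b" for a b
    using D that IV_down by blast
  fix a b assume "a \<in> \<Union>D" "b \<in> \<Union>D"
  then obtain R S where "R \<in> D" "S \<in> D" "a \<in> R" "b \<in> S" by blast
  moreover then obtain T where "T \<in> D" "R \<subseteq> T" "S \<subseteq> T"
    using assms(1) unfolding directed_in_def by blast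
  ultimately have "\<exists>c\<in>T. ll a c \<and> ll b c" using IV_dir[of T a b] D by blast
  then show "\<exists>c\<in>\<Union>D. ll a c \<and> ll b c" using \<open>T \<in> D\<close> by blast
qed

lemma is_lub_Union_iff:
  "\<Union>D \<in> A \<Longrightarrow> is_lub A (\<subseteq>) D s \<longleftrightarrow> s = \<Union>D"
  unfolding is_lub_def by (auto 4 3)

text \<open>Directed suprema of round ideals are unions, so a string of the supremum already occurs
  in a member. These open sets detect unbounded strings.\<close>

lemma scott_open_mem: "scott_open (IV L le) (\<subseteq>) {R \<in> IV L le. b \<in> R}"
  unfolding scott_open_def
proof (intro conjI allI impI)
  fix D s
  assume *: "directed_in (IV L le) (\<subseteq>) D \<and> is_lub (IV L le) (\<subseteq>) D s \<and> s \<in> {R \<in> IV L le. b \<in> R}"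
  then have "s = \<Union>D" using is_lub_Union_iff[OF IV_Union[of "IV L le" D]] by blast
  then obtain R where "R \<in> D" "b \<in> R" using * by blast
  moreover have "D \<subseteq> IV L le" using * by (simp add: directed_in_def)
  ultimately show "D \<inter> {R \<in> IV L le. b \<in> R} \<noteq> {}" by blast
qed auto

text \<open>Roundness puts every string of \<open>R\<close> strictly below another one, hence into
  some principal ideal. The ambient set \<open>A\<close> is left open since the directed family is
  needed both in \<open>IV L le\<close> and in the closure.\<close>

lemma IV_directed_DDown:
  assumes R: "R \<in> IV L le" and "\<And>b. b \<in> R \<Longrightarrow> DDown L le {b} \<in> A"
  shows "directed_in A (\<subseteq>) ((\<lambda>b. DDown L le {b}) ` R)"
    and "\<Union>((\<lambda>b. DDown L le {b}) ` R) = R"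
proof -
  have "directed_in (B_plus L) ll R"
    unfolding directed_in_def using IV_B_plus[OF R] IV_ne[OF R] IV_dir[OF R] by blast
  then show "directed_in A (\<subseteq>) ((\<lambda>b. DDown L le {b}) ` R)"
    by (rule directed_in_image) (use assms(2) in \<open>auto simp: DDown_single intro: ll_trans\<close>)
  show "\<Union>((\<lambda>b. DDown L le {b}) ` R) = R"
  proof (intro equalityI subsetI)
    show "a \<in> R" if "a \<in> \<Union>((\<lambda>b. DDown L le {b}) ` R)" for a
      using that IV_down[OF R] by (auto simp: DDown_single)
    show "a \<in> \<Union>((\<lambda>b. DDown L le {b}) ` R)" if "a \<in> R" for a
      using IV_round[OF R that] IV_B_plus[OF R that] by (auto simp: DDown_single)
  qed
qed

text \<open>If \<open>R\<close> is in the closure and \<open>b\<close> in \<open>R\<close>, the open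
  set of ideals containing \<open>b\<close> meets the basis, so \<open>b\<close> lies below a
  bounded string. Conversely, an ideal of bounded strings is the directed supremum of basis
  elements, so every open set around it meets the basis.\<close>

lemma IVc_eq: "IVc L le = {R \<in> IV L le. \<forall>b\<in>R. bnd b}"
proof -
  have "scott_open (IV L le) (\<subseteq>) (IV L le)"
    unfolding scott_open_def directed_in_def by blast
  moreover have "U \<subseteq> IV L le" if "scott_open (IV L le) (\<subseteq>) U" for U
    using that by (simp add: scott_open_def)
  ultimately have top: "topspace (scott_topology (IV L le) (\<subseteq>)) = IV L le"
    unfolding topspace_def openin_scott_topology by blast
  show ?thesis
  proof (intro equalityI subsetI)
    fix R assume "R \<in> IVc L le"
    then have R: "R \<in> IV L le"
      "\<And>U. scott_open (IV L le) (\<subseteq>) U \<Longrightarrow> R \<in> U \<Longrightarrow> \<exists>S\<in>bounded_basis L le. S \<in> U"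
      unfolding IVc_def closure_of_def top openin_scott_topology by auto
    have "bnd b" if "b \<in> R" for b
    proof -
      have "\<exists>S\<in>bounded_basis L le. S \<in> {R \<in> IV L le. b \<in> R}"
        using R that scott_open_mem by blast
      then obtain c where "bnd c" "b \<in> DDown L le {c}" unfolding bounded_basis_eq by blast
      then show ?thesis using bnd_ll by (auto simp: DDown_single)
    qed
    then show "R \<in> {R \<in> IV L le. \<forall>b\<in>R. bnd b}" using R(1) by blast
  next
    fix R assume "R \<in> {R \<in> IV L le. \<forall>b\<in>R. bnd b}"
    then have R: "R \<in> IV L le" "\<And>b. b \<in> R \<Longrightarrow> bnd b" by auto
    have "\<exists>S\<in>bounded_basis L le. S \<in> U" if U: "scott_open (IV L le) (\<subseteq>) U" "R \<in> U" for U
    proof -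
      let ?D = "(\<lambda>b. DDown L le {b}) ` R"
      have D: "directed_in (IV L le) (\<subseteq>) ?D" "\<Union>?D = R"
        using IV_directed_DDown[OF R(1), of "IV L le"] DDown_IV IV_B_plus[OF R(1)] by auto
      moreover have "is_lub (IV L le) (\<subseteq>) ?D R"
        using is_lub_Union_iff[of ?D "IV L le" R] D(2) R(1) by simp
      ultimately have "?D \<inter> U \<noteq> {}" using U unfolding scott_open_def by blast
      then show ?thesis
        unfolding bounded_basis_eq using R(2) IV_B_plus[OF R(1)] by blast
    qed
    then show "R \<in> IVc L le"
      unfolding IVc_def closure_of_def top openin_scott_topology using R(1) by auto
  qed
qed

lemma IVc_IV: "R \<in> IVc L le \<Longrightarrow> R \<in> IV L le"
  and IVc_bnd: "R \<in> IVc L le \<Longrightarrow> b \<in> R \<Longrightarrow> bnd b"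
  by (auto simp: IVc_eq)

lemma IVc_subset: "IVc L le \<subseteq> IV L le"
  using IVc_IV by blast

lemma IVc_Union: "directed_in (IVc L le) (\<subseteq>) D \<Longrightarrow> \<Union>D \<in> IVc L le"
  using IV_Union[OF _ IVc_subset] by (auto simp: IVc_eq directed_in_def)

lemma is_lub_IVc_iff:
  "directed_in (IVc L le) (\<subseteq>) D \<Longrightarrow> is_lub (IVc L le) (\<subseteq>) D s \<longleftrightarrow> s = \<Union>D"
  using is_lub_Union_iff IVc_Union by blast

lemma IVc_DDown: "b \<in> B_plus L \<Longrightarrow> bnd b \<Longrightarrow> DDown L le {b} \<in> IVc L le"
  using DDown_IV by (auto simp: IVc_eq DDown_single intro: bnd_ll)

lemma IVc_zero: "IV_zero \<in> IVc L le"
  using IV_zero_IV by (simp add: IVc_eq) (simp add: IV_zero_def)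

lemma IVc_scale: "R \<in> IVc L le \<Longrightarrow> IV_scale L le r R \<in> IVc L le"
  using IV_scale_IV[OF IVc_IV] by (auto simp: IVc_eq elim!: IV_scale_memE)

lemma IVc_add:
  assumes "consistent (IVc L le) (\<subseteq>) R S"
  shows "IV_add L le R S \<in> IVc L le"
proof -
  obtain T where T: "R \<in> IVc L le" "S \<in> IVc L le" "T \<in> IVc L le" "R \<subseteq> T" "S \<subseteq> T"
    using assms unfolding consistent_def by blast
  have "bnd c" if "c \<in> IV_add L le R S" for c
    using IVc_IV[OF T(1)] IVc_IV[OF T(2)] that
  proof (cases rule: IV_add_memE)
    case (1 a b)
    \<comment> \<open>The common upper bound \<open>T\<close> need not contain \<open>a + b\<close>,
      but it contains a string \<open>d\<close> above both summands, and \<open>d\<close> is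
      bounded.\<close>
    then obtain d where "d \<in> T" "ll a d" "ll b d" using IV_dir[OF IVc_IV[OF T(3)], of a b] T by blast
    then show ?thesis using bnd_ll_plus IVc_bnd[OF T(3)] 1 by blast
  qed
  then show ?thesis using IV_add_IV[OF IVc_IV[OF T(1)] IVc_IV[OF T(2)]] by (simp add: IVc_eq)
qed

section \<open>The unit map\<close>

lemma IVc_eta: "x \<in> L \<Longrightarrow> eta L le x \<in> IVc L le"
  unfolding eta_def using le_refl by (intro IVc_DDown) (auto simp: bnd_def)

lemma eta_memE:
  assumes "c \<in> eta L le x"
  obtains "c = {#}" | r y where "c = {#(r, y)#}" "0 < r" "r < 1" "wb y x"
proof -
  have "c \<in> B_plus L" "mset_emb pll c {#(1, x)#}"
    using assms by (auto simp: eta_def DDown_single ll_plus_eq)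
  then show thesis using that by (auto simp: mset_emb_add_right_iff[of pll c] B_plus_def)
qed

lemma eta_memI:
  assumes "0 < r" "r < 1" "wb y x"
  shows "{#(r, y)#} \<in> eta L le x"
proof -
  have "mset_emb pll {#(r, y)#} {#(1, x)#}"
    using assms by (intro mset_emb_add mset_emb_empty) simp
  then show ?thesis using assms wbD by (simp add: eta_def DDown_single ll_plus_eq)
qed

lemma eta_scott_continuous: "scott_continuous L le (IVc L le) (\<subseteq>) (eta L le)"
  unfolding scott_continuous_def
proof (intro conjI allI impI; (elim conjE)?)
  show "eta L le \<in> L \<rightarrow> IVc L le" using IVc_eta by blast
  fix D s assume D: "directed_in L le D" "is_lub L le D s"
  have DL: "D \<subseteq> L" "D \<noteq> {}" using D(1) by (auto simp: directed_in_def)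
  have s: "s \<in> L" "\<And>d. d \<in> D \<Longrightarrow> le d s" using D(2) by (auto simp: is_lub_def)
  have mono: "eta L le x \<subseteq> eta L le y" if xy: "y \<in> L" "le x y" for x y
  proof
    fix c assume "c \<in> eta L le x"
    then show "c \<in> eta L le y"
    proof (cases rule: eta_memE)
      case 1
      then show ?thesis using IV_empty_mem[OF eta_IV] xy by simp
    next
      case (2 r z)
      then show ?thesis using eta_memI wb_le_trans xy by simp
    qed
  qed
  have "directed_in (IVc L le) (\<subseteq>) (eta L le ` D)"
    by (rule directed_in_image[OF D(1)]) (use DL IVc_eta mono in blast)+
  moreover have "\<Union>(eta L le ` D) = eta L le s"
  proof (intro equalityI subsetI)
    show "c \<in> eta L le s" if "c \<in> \<Union>(eta L le ` D)" for c
      using that mono[OF s(1) s(2)] by blast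
    fix c assume "c \<in> eta L le s"
    then show "c \<in> \<Union>(eta L le ` D)"
    proof (cases rule: eta_memE)
      case 1
      then show ?thesis using IV_empty_mem[OF eta_IV] DL by blast
    next
      case (2 r y)
      \<comment> \<open>Directedness yields only \<open>le z d\<close> for some \<open>d\<close> in
        \<open>D\<close>; the interpolant \<open>z\<close> keeps \<open>y\<close> way below that
        \<open>d\<close>.\<close>
      obtain z where z: "wb y z" "wb z s" using wb_interpolate_single 2(4) by blast
      then obtain d where "d \<in> D" "le z d"
        using D s(1) le_refl unfolding way_below_def by blast
      then have "wb y d" using z(1) wb_le_trans DL by blast
      then show ?thesis using eta_memI[OF 2(2,3)] 2(1) \<open>d \<in> D\<close> by blast
    qed
  qed
  ultimately show "is_lub (IVc L le) (\<subseteq>) (eta L le ` D) (eta L le s)"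
    using is_lub_IVc_iff by blast
qed

section \<open>Scott continuity of the operations\<close>

lemma IVc_add_continuous:
  assumes D: "directed_in (IVc L le \<times> IVc L le) (rel_prod (\<subseteq>) (\<subseteq>)) D"
    and cons: "\<And>R S. (R, S) \<in> D \<Longrightarrow> consistent (IVc L le) (\<subseteq>) R S"
    and lub: "is_lub (IVc L le \<times> IVc L le) (rel_prod (\<subseteq>) (\<subseteq>)) D (X, Y)"
  shows "is_lub (IVc L le) (\<subseteq>) ((\<lambda>(R, S). IV_add L le R S) ` D) (IV_add L le X Y)"
proof -
  have XY: "X = \<Union>(fst ` D)" "Y = \<Union>(snd ` D)"
    using is_lub_prodD[OF lub] directed_in_prodD[OF D] is_lub_IVc_iff by auto
  have XYc: "X \<in> IV L le" "Y \<in> IV L le" using lub IVc_IV by (auto simp: is_lub_def)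
  have DI: "p \<in> D \<Longrightarrow> fst p \<in> IV L le \<and> snd p \<in> IV L le" for p
    using D IVc_IV by (auto simp: directed_in_def)
  have "directed_in (IVc L le) (\<subseteq>) ((\<lambda>(R, S). IV_add L le R S) ` D)"
  proof (rule directed_in_image[OF D])
    show "(case p of (R, S) \<Rightarrow> IV_add L le R S) \<in> IVc L le" if "p \<in> D" for p
      using that cons[of "fst p" "snd p"] IVc_add by (simp add: case_prod_beta)
    fix p q assume "p \<in> D" "q \<in> D" "rel_prod (\<subseteq>) (\<subseteq>) p q"
    then show "(case p of (R, S) \<Rightarrow> IV_add L le R S) \<subseteq> (case q of (R, S) \<Rightarrow> IV_add L le R S)"
      using DI[of p] DI[of q] by (simp add: rel_prod_sel case_prod_beta IV_add_mono)
  qed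
  moreover have "\<Union>((\<lambda>(R, S). IV_add L le R S) ` D) = IV_add L le X Y"
  proof (intro equalityI subsetI)
    fix c assume "c \<in> \<Union>((\<lambda>(R, S). IV_add L le R S) ` D)"
    then obtain p where p: "p \<in> D" "c \<in> IV_add L le (fst p) (snd p)" by auto
    then have "IV_add L le (fst p) (snd p) \<subseteq> IV_add L le X Y"
      using DI[OF p(1)] XYc XY by (intro IV_add_mono) auto
    then show "c \<in> IV_add L le X Y" using p(2) by blast
  next
    fix c assume "c \<in> IV_add L le X Y"
    with XYc obtain a b where ab: "c = a + b" "a \<in> X" "b \<in> Y" by (rule IV_add_memE)
    then obtain p q where "p \<in> D" "a \<in> fst p" "q \<in> D" "b \<in> snd q" unfolding XY by blast
    moreover then obtain z where "z \<in> D" "rel_prod (\<subseteq>) (\<subseteq>) p z" "rel_prod (\<subseteq>) (\<subseteq>) q z"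
      using D unfolding directed_in_def by blast
    ultimately have z: "z \<in> D" "a \<in> fst z" "b \<in> snd z" by (auto simp: rel_prod_sel)
    then have "c \<in> IV_add L le (fst z) (snd z)" unfolding ab using DI IV_add_memI by blast
    then show "c \<in> \<Union>((\<lambda>(R, S). IV_add L le R S) ` D)" using z(1) by (auto simp: case_prod_beta)
  qed
  ultimately show ?thesis using is_lub_IVc_iff by blast
qed

lemma IVc_scale_continuous:
  "scott_continuous (UNIV \<times> IVc L le) (rel_prod (\<le>) (\<subseteq>)) (IVc L le) (\<subseteq>)
     (\<lambda>(r, R). IV_scale L le r R)"
  unfolding scott_continuous_def
proof (intro conjI allI impI; (elim conjE)?)
  show "(\<lambda>(r, R). IV_scale L le r R) \<in> UNIV \<times> IVc L le \<rightarrow> IVc L le" using IVc_scale by auto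
  fix D :: "(ennreal \<times> _) set" and s
  assume D: "directed_in (UNIV \<times> IVc L le) (rel_prod (\<le>) (\<subseteq>)) D"
    and lub: "is_lub (UNIV \<times> IVc L le) (rel_prod (\<le>) (\<subseteq>)) D s"
  obtain r X where s: "s = (r, X)" by fastforce
  have X: "X = \<Union>(snd ` D)"
    using is_lub_prodD(2)[OF lub[unfolded s]] directed_in_prodD[OF D] is_lub_IVc_iff by auto
  have r: "is_lub UNIV (\<le>) (fst ` D) r" using is_lub_prodD(1)[OF lub[unfolded s]] .
  have XI: "X \<in> IV L le" using lub IVc_IV by (auto simp: is_lub_def s)
  have DI: "p \<in> D \<Longrightarrow> snd p \<in> IVc L le" for p using D by (auto simp: directed_in_def)
  have ne: "D \<noteq> {}" using D by (simp add: directed_in_def)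
  have "directed_in (IVc L le) (\<subseteq>) ((\<lambda>(r, R). IV_scale L le r R) ` D)"
  proof (rule directed_in_image[OF D])
    show "(case p of (r, R) \<Rightarrow> IV_scale L le r R) \<in> IVc L le" if "p \<in> D" for p
      using DI[OF that] IVc_scale by (simp add: case_prod_beta)
    fix p q assume "p \<in> D" "q \<in> D" "rel_prod (\<le>) (\<subseteq>) p q"
    then show "(case p of (r, R) \<Rightarrow> IV_scale L le r R) \<subseteq> (case q of (r, R) \<Rightarrow> IV_scale L le r R)"
      using DI[of p] DI[of q] IVc_IV by (simp add: rel_prod_sel case_prod_beta IV_scale_mono)
  qed
  moreover have "\<Union>((\<lambda>(r, R). IV_scale L le r R) ` D) = IV_scale L le r X"
  proof (intro equalityI subsetI)
    fix c assume "c \<in> \<Union>((\<lambda>(r, R). IV_scale L le r R) ` D)"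
    then obtain p where p: "p \<in> D" "c \<in> IV_scale L le (fst p) (snd p)" by auto
    have "fst p \<le> r" using r p(1) by (simp add: is_lub_def)
    then have "IV_scale L le (fst p) (snd p) \<subseteq> IV_scale L le r X"
      using IVc_IV[OF DI[OF p(1)]] XI p(1) X by (intro IV_scale_mono) auto
    then show "c \<in> IV_scale L le r X" using p(2) by blast
  next
    fix c assume c: "c \<in> IV_scale L le r X"
    have mem: "c \<in> \<Union>((\<lambda>(r, R). IV_scale L le r R) ` D)"
      if "p \<in> D" "c \<in> IV_scale L le (fst p) (snd p)" for p
      using that by (auto simp: case_prod_beta)
    from XI c show "c \<in> \<Union>((\<lambda>(r, R). IV_scale L le r R) ` D)"
    proof (cases rule: IV_scale_memE)
      case 1
      obtain p where "p \<in> D" using ne by blast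
      then show ?thesis using mem[of p] IV_scale_empty_mem IVc_IV[OF DI] 1 by simp
    next
      case (2 t b)
      \<comment> \<open>Scalar and ideal are approximated by different members of \<open>D\<close>:
        \<open>p\<close> has a scalar above \<open>t\<close>, while \<open>q\<close> contains
        \<open>b\<close>. Directedness supplies one \<open>z\<close> with both properties.\<close>
      have "\<exists>p\<in>D. ennreal t < fst p"
      proof (rule ccontr)
        assume "\<not> ?thesis"
        then have "\<forall>u\<in>fst ` D. u \<le> ennreal t" by (auto simp: not_less)
        then have "r \<le> ennreal t" using r unfolding is_lub_def by blast
        then show False using 2(3) by simp
      qed
      then obtain p where p: "p \<in> D" "ennreal t < fst p" by blast
      obtain q where q: "q \<in> D" "b \<in> snd q" using 2(4) X by blast
      obtain z where "z \<in> D" "rel_prod (\<le>) (\<subseteq>) p z" "rel_prod (\<le>) (\<subseteq>) q z"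
        using D p(1) q(1) unfolding directed_in_def by blast
      then have z: "z \<in> D" "ennreal t < fst z" "b \<in> snd z"
        using p q by (auto simp: rel_prod_sel)
      then show ?thesis using mem[of z] IV_scale_memI[OF IVc_IV[OF DI]] 2 by simp
    qed
  qed
  ultimately show "is_lub (IVc L le) (\<subseteq>) ((\<lambda>(r, R). IV_scale L le r R) ` D)
      (case s of (r, R) \<Rightarrow> IV_scale L le r R)"
    using is_lub_IVc_iff by (simp add: s)
qed

section \<open>Soundness of deductions\<close>

lemma eval_term_IV:
  "range \<rho> \<subseteq> IV L le \<Longrightarrow> eval_term (IVc_cone L le) \<rho> t \<in> IV L le"
  by (induction t) (auto simp: IVc_cone_def IV_zero_IV IV_add_IV IV_scale_IV)

lemma quasi_cone_law_IV:
  assumes "quasi_cone_law s t" "range \<rho> \<subseteq> IV L le"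
  shows "eval_term (IVc_cone L le) \<rho> s = eval_term (IVc_cone L le) \<rho> t"
proof -
  note ev = eval_term_IV[OF assms(2)]
  have sel: "qadd (IVc_cone L le) = IV_add L le" "qscale (IVc_cone L le) = IV_scale L le"
    "qzero (IVc_cone L le) = IV_zero"
    by (auto simp: IVc_cone_def)
  show ?thesis
    using assms(1)
  proof cases
    case (add_comm x y)
    then show ?thesis by (simp add: sel IV_add_comm[OF ev ev])
  qed (simp_all add: sel ev IV_add_assoc IV_zero_add IV_one_scale IV_zero_scale
      IV_mult_scale IV_scale_add)
qed

text \<open>The assignment ranges over all of \<open>IV L le\<close>, where addition and the laws
  are total, so intermediate terms of a deduction need no consistent arguments. Only the operations
  of \<open>IVc_cone\<close> matter here, not its carrier.\<close>

lemma deducible_IV: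
  assumes "deducible s t" "range \<rho> \<subseteq> IV L le"
  shows "eval_term (IVc_cone L le) \<rho> s \<subseteq> eval_term (IVc_cone L le) \<rho> t"
  using assms
proof (induction rule: deducible.induct)
  case (add_mono s s' t t')
  have "IV_add L le (eval_term (IVc_cone L le) \<rho> s) (eval_term (IVc_cone L le) \<rho> t)
    \<subseteq> IV_add L le (eval_term (IVc_cone L le) \<rho> s') (eval_term (IVc_cone L le) \<rho> t')"
    using add_mono by (intro IV_add_mono eval_term_IV) auto
  then show ?case by (simp add: IVc_cone_def)
next
  case (scale_mono r r' t t')
  have "IV_scale L le r (eval_term (IVc_cone L le) \<rho> t)
    \<subseteq> IV_scale L le r' (eval_term (IVc_cone L le) \<rho> t')"
    using scale_mono by (intro IV_scale_mono eval_term_IV) auto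
  then show ?case by (simp add: IVc_cone_def)
qed (auto simp: quasi_cone_law_IV)

lemma IVc_consistent_dcpo_quasi_cone: "consistent_dcpo_quasi_cone (IVc_cone L le)"
proof -
  have sel: "qcarrier (IVc_cone L le) = IVc L le" "qle (IVc_cone L le) = (\<subseteq>)"
    "qadd (IVc_cone L le) = IV_add L le" "qscale (IVc_cone L le) = IV_scale L le"
    "qzero (IVc_cone L le) = IV_zero"
    by (auto simp: IVc_cone_def)
  have "dcpo (IVc L le) (\<subseteq>)"
    unfolding dcpo_def poset_on_def using is_lub_IVc_iff
    by (auto simp: reflp_on_def transp_on_def antisymp_on_def)
  moreover have "eval_term (IVc_cone L le) \<rho> s \<subseteq> eval_term (IVc_cone L le) \<rho> t"
    if "deducible s t" "range \<rho> \<subseteq> IVc L le" for s t \<rho>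
    using deducible_IV that IVc_subset by blast
  ultimately show ?thesis
    unfolding consistent_dcpo_quasi_cone_def sel
  proof (intro conjI allI impI; (elim conjE)?)
    fix D X Y
    assume D: "directed_in (IVc L le \<times> IVc L le) (rel_prod (\<subseteq>) (\<subseteq>)) D"
      and cons: "\<forall>(R, S)\<in>D. consistent (IVc L le) (\<subseteq>) R S"
      and lub: "is_lub (IVc L le \<times> IVc L le) (rel_prod (\<subseteq>) (\<subseteq>)) D (X, Y)"
    show "is_lub (IVc L le) (\<subseteq>) ((\<lambda>(R, S). IV_add L le R S) ` D) (IV_add L le X Y)"
      by (rule IVc_add_continuous[OF D _ lub]) (use cons in blast)
  qed (use IVc_zero IVc_add IVc_scale_continuous in simp_all)
qed

end

section \<open>Arithmetic in a consistent dcpo quasi-cone\<close>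

locale dcpo_quasi_cone =
  fixes Q :: "'q quasi_cone"
  assumes cone: "consistent_dcpo_quasi_cone Q"
begin

abbreviation "C \<equiv> qcarrier Q"
abbreviation "leq \<equiv> qle Q"
abbreviation "cons \<equiv> consistent (qcarrier Q) (qle Q)"

lemma dcpo: "dcpo C leq"
  and zero_C: "qzero Q \<in> C"
  and add_C: "cons x y \<Longrightarrow> qadd Q x y \<in> C"
  and scale_continuous: "scott_continuous (UNIV \<times> C) (rel_prod (\<le>) leq) C leq (\<lambda>(r, x). qscale Q r x)"
  using cone by (simp_all add: consistent_dcpo_quasi_cone_def)

lemma add_lub:
  assumes "directed_in (C \<times> C) (rel_prod leq leq) D" "\<And>x y. (x, y) \<in> D \<Longrightarrow> cons x y"
    "is_lub (C \<times> C) (rel_prod leq leq) D (x, y)" "cons x y"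
  shows "is_lub C leq ((\<lambda>(x, y). qadd Q x y) ` D) (qadd Q x y)"
proof -
  have "\<forall>(a, b)\<in>D. cons a b" using assms(2) by blast
  then show ?thesis using cone assms(1,3,4) unfolding consistent_dcpo_quasi_cone_def by metis
qed

lemma poset: "poset_on C leq"
  and ex_lub: "directed_in C leq D \<Longrightarrow> \<exists>s. is_lub C leq D s"
  using dcpo by (auto simp: dcpo_def)

lemma leq_refl: "x \<in> C \<Longrightarrow> leq x x"
  using poset by (simp add: poset_on_def reflp_on_def)

lemma leq_trans: "leq x y \<Longrightarrow> leq y z \<Longrightarrow> x \<in> C \<Longrightarrow> y \<in> C \<Longrightarrow> z \<in> C \<Longrightarrow> leq x z"
  using poset unfolding poset_on_def transp_on_def by blast

lemma leq_antisym: "leq x y \<Longrightarrow> leq y x \<Longrightarrow> x \<in> C \<Longrightarrow> y \<in> C \<Longrightarrow> x = y"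
  using poset unfolding poset_on_def antisymp_on_def by blast

lemma consI: "leq x u \<Longrightarrow> leq y u \<Longrightarrow> x \<in> C \<Longrightarrow> y \<in> C \<Longrightarrow> u \<in> C \<Longrightarrow> cons x y"
  unfolding consistent_def by blast

lemma consD: "cons x y \<Longrightarrow> x \<in> C" "cons x y \<Longrightarrow> y \<in> C"
  unfolding consistent_def by blast+

lemma cons_sym: "cons x y \<Longrightarrow> cons y x"
  unfolding consistent_def by blast

lemma scale_C: "x \<in> C \<Longrightarrow> qscale Q r x \<in> C"
  using scale_continuous funcset_mem[of "\<lambda>(r, x). qscale Q r x" "UNIV \<times> C" C "(r, x)"]
  by (simp add: scott_continuous_def)

lemma scale_mono:
  assumes "r \<le> s" "leq x y" "x \<in> C" "y \<in> C"
  shows "leq (qscale Q r x) (qscale Q s y)"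
proof -
  have "reflp_on (UNIV \<times> C) (rel_prod (\<le>) leq :: ennreal \<times> 'q \<Rightarrow> _)"
    using leq_refl by (auto simp: reflp_on_def rel_prod_sel)
  then show ?thesis
    using scott_continuous_mono[OF scale_continuous, of "(r, x)" "(s, y)"] assms by simp
qed

text \<open>Deducible inequations compare terms, not arbitrary ordered elements. Monotonicity in the
  arguments therefore comes from partial Scott continuity, applied to the two-element chain of
  pairs.\<close>

lemma add_mono:
  assumes "leq x x'" "leq y y'" "x \<in> C" "y \<in> C" "cons x' y'"
  shows "cons x y" "leq (qadd Q x y) (qadd Q x' y')"
proof -
  note C = consD[OF assms(5)]
  obtain u where u: "u \<in> C" "leq x' u" "leq y' u" using assms(5) unfolding consistent_def by blast
  show cons: "cons x y"
    using leq_trans[OF assms(1) u(2)] leq_trans[OF assms(2) u(3)] C u(1) assms(3,4) consI by metis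
  let ?D = "{(x, y), (x', y')}"
  have "reflp_on (C \<times> C) (rel_prod leq leq)"
    using leq_refl by (auto simp: reflp_on_def rel_prod_sel)
  note D = is_lub_directed_pair[OF this, of "(x, y)" "(x', y')"]
  have "is_lub C leq ((\<lambda>(x, y). qadd Q x y) ` ?D) (qadd Q x' y')"
    by (rule add_lub) (use D cons assms C in auto)
  then show "leq (qadd Q x y) (qadd Q x' y')" by (simp add: is_lub_def)
qed

lemma deducible_leq:
  "deducible s t \<Longrightarrow> range \<rho> \<subseteq> C \<Longrightarrow> defined_term Q \<rho> s \<Longrightarrow> defined_term Q \<rho> t \<Longrightarrow>
     leq (eval_term Q \<rho> s) (eval_term Q \<rho> t)"
  using cone unfolding consistent_dcpo_quasi_cone_def by blast

lemma eval_term_C: "range \<rho> \<subseteq> C \<Longrightarrow> defined_term Q \<rho> t \<Longrightarrow> eval_term Q \<rho> t \<in> C"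
  by (induction t) (auto simp: zero_C add_C scale_C)

lemma law_eq:
  assumes "quasi_cone_law s t" "range \<rho> \<subseteq> C" "defined_term Q \<rho> s" "defined_term Q \<rho> t"
  shows "eval_term Q \<rho> s = eval_term Q \<rho> t"
  using assms by (intro leq_antisym deducible_leq eval_term_C) (auto intro: deducible.intros)

definition env :: "'q \<Rightarrow> 'q \<Rightarrow> 'q \<Rightarrow> nat \<Rightarrow> 'q" where
  "env x y z i = (if i = 0 then x else if i = 1 then y else z)"

lemma env_simps [simp]: "env x y z 0 = x" "env x y z (Suc 0) = y" "env x y z 2 = z"
  by (auto simp: env_def)

lemma env_C: "x \<in> C \<Longrightarrow> y \<in> C \<Longrightarrow> z \<in> C \<Longrightarrow> range (env x y z) \<subseteq> C"
  by (auto simp: env_def)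

lemma zero_leq: "x \<in> C \<Longrightarrow> leq (qzero Q) x"
proof -
  assume x: "x \<in> C"
  \<comment> \<open>The chain is \<open>0 = 0 x \<le> 1 x = x\<close>, by monotonicity in the
    scalar.\<close>
  have "deducible Zero (Var 0)"
    by (rule deducible.trans[OF deducible.law_sym[OF zero_scale]
          deducible.trans[OF deducible.scale_mono[of 0 1] deducible.law[OF one_scale]]])
      (auto intro: deducible.refl)
  then show ?thesis using deducible_leq[OF _ env_C[OF x x x]] by fastforce
qed

lemma cons_zero: "x \<in> C \<Longrightarrow> cons (qzero Q) x"
  using consI[OF zero_leq leq_refl] zero_C by blast

lemma zero_add: "x \<in> C \<Longrightarrow> qadd Q (qzero Q) x = x"
  using law_eq[OF quasi_cone_law.zero_add[of "Var 0"] env_C[of x x x]] cons_zero by simp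

lemma one_scale: "x \<in> C \<Longrightarrow> qscale Q 1 x = x"
  using law_eq[OF quasi_cone_law.one_scale[of "Var 0"] env_C[of x x x]] by simp

lemma zero_scale: "x \<in> C \<Longrightarrow> qscale Q 0 x = qzero Q"
  using law_eq[OF quasi_cone_law.zero_scale[of "Var 0"] env_C[of x x x]] by simp

lemma mult_scale: "x \<in> C \<Longrightarrow> qscale Q (r * s) x = qscale Q r (qscale Q s x)"
  using law_eq[OF quasi_cone_law.mult_scale[of r s "Var 0"] env_C[of x x x]] by simp

text \<open>Not a law itself: with zero written as \<open>0 0\<close>, the scalar \<open>r\<close>
  is absorbed by \<open>r * 0 = 0\<close>.\<close>

lemma scale_qzero: "qscale Q r (qzero Q) = qzero Q"
  using zero_scale[OF zero_C] mult_scale[OF zero_C, of r 0] by simp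

lemma add_comm: "cons x y \<Longrightarrow> qadd Q x y = qadd Q y x"
  using law_eq[OF quasi_cone_law.add_comm[of "Var 0" "Var 1"] env_C[of x y x]] consD[of x y]
  by (simp add: cons_sym)

lemma scale_add:
  assumes "cons x y"
  shows "cons (qscale Q r x) (qscale Q r y)"
    "qscale Q r (qadd Q x y) = qadd Q (qscale Q r x) (qscale Q r y)"
proof -
  obtain u where u: "u \<in> C" "leq x u" "leq y u" using assms unfolding consistent_def by blast
  show *: "cons (qscale Q r x) (qscale Q r y)"
    by (rule consI[of _ "qscale Q r u"]) (use u consD[OF assms] scale_C scale_mono in auto)
  show "qscale Q r (qadd Q x y) = qadd Q (qscale Q r x) (qscale Q r y)"
    using law_eq[OF quasi_cone_law.scale_add[of r "Var 0" "Var 1"] env_C[of x y x]]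
      consD[OF assms] assms * by simp
qed

lemma leq_add_right: assumes "cons x y" shows "leq y (qadd Q x y)"
  using add_mono(2)[OF zero_leq leq_refl zero_C _ assms] zero_add consD[OF assms] by simp

lemma leq_add_left: "cons x y \<Longrightarrow> leq x (qadd Q x y)"
  using leq_add_right cons_sym add_comm by metis

text \<open>Definedness of one bracketing forces that of the other: the value of
  \<open>(x + y) + z\<close> is an upper bound of \<open>x\<close> and of
  \<open>y + z\<close>.\<close>

lemma add_assoc:
  assumes xy: "cons x y" and xyz: "cons (qadd Q x y) z"
  shows "cons y z" "cons x (qadd Q y z)"
    "qadd Q (qadd Q x y) z = qadd Q x (qadd Q y z)"
proof -
  note C = consD[OF xy] consD[OF xyz] add_C[OF xyz]
  show yz: "cons y z" using add_mono(1)[OF leq_add_right[OF xy] leq_refl _ _ xyz] C by simp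
  have "leq (qadd Q y z) (qadd Q (qadd Q x y) z)"
    using add_mono(2)[OF leq_add_right[OF xy] leq_refl _ _ xyz] C by simp
  moreover have "leq x (qadd Q (qadd Q x y) z)"
    using leq_trans[OF leq_add_left[OF xy] leq_add_left[OF xyz]] C by simp
  ultimately show x_yz: "cons x (qadd Q y z)" using consI C add_C[OF yz] by blast
  show "qadd Q (qadd Q x y) z = qadd Q x (qadd Q y z)"
    using law_eq[OF quasi_cone_law.add_assoc[of "Var 0" "Var 1" "Var 2"] env_C[of x y z]]
      C xy xyz yz x_yz by simp
qed

text \<open>Reading \<^const>\<open>None\<close> as an added top element makes the partial addition a total
  commutative and associative one, which can be folded over multisets.\<close>

definition oadd :: "'q option \<Rightarrow> 'q option \<Rightarrow> 'q option" where
  "oadd u v = (case (u, v) of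
     (Some x, Some y) \<Rightarrow> if cons x y then Some (qadd Q x y) else None | _ \<Rightarrow> None)"

lemma oadd_Some_iff:
  "oadd u v = Some w \<longleftrightarrow> (\<exists>x y. u = Some x \<and> v = Some y \<and> cons x y \<and> w = qadd Q x y)"
  by (auto simp: oadd_def split: option.splits)

lemma oadd_comm: "oadd u v = oadd v u"
  by (auto simp: oadd_def add_comm cons_sym split: option.splits)

lemma oadd_assoc: "oadd (oadd u v) w = oadd u (oadd v w)"
proof -
  have *: "oadd (oadd u v) w = Some t \<Longrightarrow> oadd u (oadd v w) = Some t" for u v w t
    unfolding oadd_Some_iff using add_assoc by metis
  \<comment> \<open>By commutativity the converse is the same implication for the reversed triple
    \<open>w\<close>, \<open>v\<close>, \<open>u\<close>.\<close>
  have "oadd (oadd u v) w = Some t \<longleftrightarrow> oadd u (oadd v w) = Some t" for t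
    using *[of u v w t] *[of w v u t] by (metis oadd_comm)
  then show ?thesis by (metis not_None_eq)
qed

text \<open>With \<open>None\<close> on top, \<open>oleq u (Some y)\<close> forces \<open>u\<close>
  to be defined, so that monotonicity also carries the existence of sums downwards.\<close>

definition oleq :: "'q option \<Rightarrow> 'q option \<Rightarrow> bool" where
  "oleq u v \<longleftrightarrow> v = None \<or> (\<exists>x y. u = Some x \<and> v = Some y \<and> x \<in> C \<and> y \<in> C \<and> leq x y)"

lemma oadd_mono:
  assumes "oleq u u'" "oleq v v'"
  shows "oleq (oadd u v) (oadd u' v')"
proof (cases "oadd u' v'")
  case (Some w)
  then obtain x' y' where *: "u' = Some x'" "v' = Some y'" "cons x' y'" "w = qadd Q x' y'"
    by (auto simp: oadd_Some_iff)
  then obtain x y where "u = Some x" "v = Some y" "x \<in> C" "y \<in> C" "leq x x'" "leq y y'"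
    using assms by (auto simp: oleq_def)
  then show ?thesis using add_mono[of x x' y y'] * add_C by (simp add: oleq_def oadd_def)
qed (simp add: oleq_def)

definition osum :: "('a \<Rightarrow> 'q) \<Rightarrow> (real \<times> 'a) multiset \<Rightarrow> 'q option" where
  "osum f = fold_mset (\<lambda>(r, x). oadd (Some (qscale Q (ennreal r) (f x)))) (Some (qzero Q))"

lemma osum_empty [simp]: "osum f {#} = Some (qzero Q)"
  by (simp add: osum_def)

lemma osum_add [simp]:
  "osum f (add_mset (r, x) b) = oadd (Some (qscale Q (ennreal r) (f x))) (osum f b)"
proof -
  interpret comp_fun_commute "\<lambda>(r, x). oadd (Some (qscale Q (ennreal r) (f x)))"
    by standard (auto simp: fun_eq_iff oadd_assoc[symmetric], simp add: oadd_comm)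
  show ?thesis by (simp add: osum_def)
qed

lemma osum_C: "osum f b = Some v \<Longrightarrow> v \<in> C"
  by (cases b) (auto simp: zero_C oadd_Some_iff intro: add_C)

lemma osum_plus: "osum f (a + b) = oadd (osum f a) (osum f b)"
proof (induction a)
  case empty
  then show ?case
    using osum_C[of f b] by (cases "osum f b") (auto simp: oadd_def cons_zero zero_add)
next
  case (add p a)
  then show ?case by (cases p) (simp add: oadd_assoc)
qed

text \<open>Scaling preserves consistency, so the scaled sum exists whenever the original one does,
  and distributivity over vectors moves the scalar inside.\<close>

lemma osum_scale:
  assumes "0 \<le> t" "osum f b = Some v" "f ` snd ` set_mset b \<subseteq> C"
  shows "osum f (image_mset (\<lambda>(r, x). (t * r, x)) b) = Some (qscale Q (ennreal t) v)"
  using assms(2,3)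
proof (induction b arbitrary: v)
  case empty
  then show ?case using scale_qzero[of "ennreal t"] by auto
next
  case (add p b)
  obtain r x where p: "p = (r, x)" by fastforce
  obtain w where w: "osum f b = Some w" "cons (qscale Q (ennreal r) (f x)) w"
    "v = qadd Q (qscale Q (ennreal r) (f x)) w"
    using add.prems by (auto simp: p oadd_Some_iff)
  have "qscale Q (ennreal (t * r)) (f x) = qscale Q (ennreal t) (qscale Q (ennreal r) (f x))"
    using add.prems assms(1) mult_scale[of "f x" "ennreal t" "ennreal r"]
    by (simp add: p ennreal_mult')
  then show ?case
    using add.IH[OF w(1)] add.prems scale_add[OF w(2)] w(3) by (simp add: p oadd_def)
qed

end

section \<open>Freeness\<close>

locale cone_extension = cont_dcpo L le + dcpo_quasi_cone Q
  for L :: "'a set" and le :: "'a \<Rightarrow> 'a \<Rightarrow> bool" and Q :: "'q quasi_cone" +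
  fixes f :: "'a \<Rightarrow> 'q"
  assumes f_continuous: "scott_continuous L le C leq f"
begin

section \<open>Existence of the extension\<close>

lemma f_C: "x \<in> L \<Longrightarrow> f x \<in> C"
  using f_continuous by (auto simp: scott_continuous_def)

lemma f_mono: "x \<in> L \<Longrightarrow> y \<in> L \<Longrightarrow> le x y \<Longrightarrow> leq (f x) (f y)"
  using scott_continuous_mono[OF f_continuous reflp_le] by blast

lemma f_B_plus: "b \<in> B_plus L \<Longrightarrow> f ` snd ` set_mset b \<subseteq> C"
  using f_C by (auto simp: B_plus_def)

lemma osum_mono:
  assumes "ll a b"
  shows "oleq (osum f a) (osum f b)"
  using assms unfolding ll_plus_eq
proof (induction rule: mset_emb.induct)
  case (mset_emb_empty b)
  then show ?case
    using osum_C[of f b] zero_C zero_leq by (cases "osum f b") (auto simp: oleq_def)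
next
  case (mset_emb_add p q a b)
  obtain r x s y where p: "p = (r, x)" "q = (s, y)" by fastforce
  have rs: "r < s" "wb x y" using mset_emb_add.hyps(1) by (auto simp: p)
  note L = wbD[OF rs(2)]
  have "leq (qscale Q (ennreal r) (f x)) (qscale Q (ennreal s) (f y))"
    using rs L by (intro scale_mono f_mono f_C wb_imp_le ennreal_leI) auto
  then have "oleq (Some (qscale Q (ennreal r) (f x))) (Some (qscale Q (ennreal s) (f y)))"
    using f_C L scale_C by (simp add: oleq_def)
  then show ?case unfolding p osum_add using mset_emb_add.IH by (rule oadd_mono)
qed

text \<open>The induction carries a witness \<open>w\<close> above both the partial sum and
  \<open>?U\<close>, which is \<infinity> f(u). The next summand lies below \<open>?U\<close>, hence
  below \<open>w\<close>, and \<open>w + w\<close> exists because \<open>w\<close> is consistent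
  with itself. It bounds the new sum and is still above \<open>?U\<close>. A fixed bound
  \<open>?U\<close> would not do, since \<open>?U + ?U\<close> may be strictly larger.\<close>

lemma osum_bnd:
  assumes "b \<in> B_plus L" "bnd b"
  obtains v where "osum f b = Some v"
proof (cases "b = {#}")
  case False
  then obtain u where u: "u \<in> L" "\<forall>x\<in>snd ` set_mset b. le x u"
    using assms(2) by (auto simp: bnd_def)
  let ?U = "qscale Q \<infinity> (f u)"
  have U: "?U \<in> C" using u f_C scale_C by blast
  have "\<exists>v w. osum f b = Some v \<and> v \<in> C \<and> w \<in> C \<and> leq v w \<and> leq ?U w"
    using assms(1) u(2)
  proof (induction b)
    case empty
    show ?case using zero_C zero_leq[OF U] leq_refl[OF U] U by auto
  next
    case (add p b)
    obtain r x where p: "p = (r, x)" by fastforce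
    have x: "x \<in> L" "le x u" using add.prems by (auto simp: p)
    obtain v w where vw: "osum f b = Some v" "v \<in> C" "w \<in> C" "leq v w" "leq ?U w"
      using add by auto
    let ?v = "qscale Q (ennreal r) (f x)"
    have v: "?v \<in> C" using f_C x scale_C by blast
    have "leq ?v ?U" using x u(1) by (intro scale_mono f_mono f_C) auto
    then have "leq ?v w" using leq_trans[OF _ vw(5)] v U vw(3) by blast
    moreover have ww: "cons w w" using vw(3) leq_refl consI by blast
    ultimately have *: "cons ?v v" "leq (qadd Q ?v v) (qadd Q w w)"
      using add_mono[OF _ vw(4) v vw(2)] by blast+
    have "leq ?U (qadd Q w w)"
      using leq_trans[OF vw(5) leq_add_right[OF ww]] U vw(3) add_C[OF ww] by blast
    then show ?case
      using * vw(1) add_C[OF ww] add_C[OF *(1)] by (auto simp: p oadd_def)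
  qed
  then show thesis using that by blast
qed (use that in simp)

text \<open>Meaningful only where the sum exists; by \<open>osum_val\<close> this covers every
  string of a member of the closure.\<close>

definition val :: "(real \<times> 'a) multiset \<Rightarrow> 'q" where
  "val b = the (osum f b)"

lemma osum_val: "R \<in> IVc L le \<Longrightarrow> b \<in> R \<Longrightarrow> osum f b = Some (val b)"
  unfolding val_def by (metis IV_B_plus IVc_IV IVc_bnd option.sel osum_bnd)

lemma val_C: "R \<in> IVc L le \<Longrightarrow> b \<in> R \<Longrightarrow> val b \<in> C"
  using osum_val osum_C by blast

lemma val_empty [simp]: "val {#} = qzero Q"
  by (simp add: val_def)

lemma val_plus:
  "osum f a = Some (val a) \<Longrightarrow> osum f b = Some (val b) \<Longrightarrow> cons (val a) (val b) \<Longrightarrow>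
     val (a + b) = qadd Q (val a) (val b)"
  unfolding val_def[of "a + b"] osum_plus by (simp add: oadd_def)

lemma val_single: "x \<in> L \<Longrightarrow> val {#(r, x)#} = qscale Q (ennreal r) (f x)"
  using cons_zero[of "qscale Q (ennreal r) (f x)"] zero_add[of "qscale Q (ennreal r) (f x)"]
    f_C scale_C
  by (simp add: val_def oadd_def cons_sym add_comm)

lemma val_sc:
  assumes "R \<in> IVc L le" "b \<in> R" "0 \<le> t"
  shows "val (sc t b) = qscale Q (ennreal t) (val b)"
proof -
  have "osum f (sc t b) = Some (qscale Q (ennreal t) (val b))"
    unfolding sc_def
    using osum_scale[OF assms(3) osum_val f_B_plus] IV_B_plus[OF IVc_IV] assms(1,2) by metis
  then show ?thesis by (simp add: val_def[of "sc t b"])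
qed

lemma directed_val:
  assumes R: "R \<in> IVc L le"
  shows "directed_in C leq (val ` R)"
proof (rule directed_in_image)
  show "directed_in (B_plus L) ll R"
    unfolding directed_in_def
    using IV_B_plus[OF IVc_IV[OF R]] IV_ne[OF IVc_IV[OF R]] IV_dir[OF IVc_IV[OF R]] by blast
  show "leq (val a) (val b)" if "a \<in> R" "b \<in> R" "ll a b" for a b
    using osum_mono[OF that(3)] osum_val[OF R] that by (simp add: oleq_def)
qed (use val_C R in blast)

definition ext :: "(real \<times> 'a) multiset set \<Rightarrow> 'q" where
  "ext R = (THE s. is_lub C leq (val ` R) s)"

lemma ext_eqI:
  assumes "is_lub C leq (val ` R) s"
  shows "ext R = s"
  unfolding ext_def using assms is_lub_unique[OF poset] by blast

lemma ext_lub: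
  assumes "R \<in> IVc L le"
  shows "is_lub C leq (val ` R) (ext R)"
  using ex_lub[OF directed_val[OF assms]] ext_eqI by metis

lemma ext_C: "R \<in> IVc L le \<Longrightarrow> ext R \<in> C"
  and val_leq_ext: "R \<in> IVc L le \<Longrightarrow> b \<in> R \<Longrightarrow> leq (val b) (ext R)"
  and ext_least: "R \<in> IVc L le \<Longrightarrow> u \<in> C \<Longrightarrow> (\<And>b. b \<in> R \<Longrightarrow> leq (val b) u) \<Longrightarrow> leq (ext R) u"
  using ext_lub unfolding is_lub_def by blast+

lemma ext_mono: "R \<in> IVc L le \<Longrightarrow> S \<in> IVc L le \<Longrightarrow> R \<subseteq> S \<Longrightarrow> leq (ext R) (ext S)"
  using ext_least val_leq_ext ext_C by blast

text \<open>A supremum over a directed union may be taken member by member.\<close>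

lemma ext_continuous: "scott_continuous (IVc L le) (\<subseteq>) C leq ext"
  unfolding scott_continuous_def
proof (intro conjI allI impI; (elim conjE)?)
  show "ext \<in> IVc L le \<rightarrow> C" using ext_C by blast
  fix D s assume D: "directed_in (IVc L le) (\<subseteq>) D" "is_lub (IVc L le) (\<subseteq>) D s"
  then have s: "s = \<Union>D" "s \<in> IVc L le" using is_lub_IVc_iff by (auto simp: is_lub_def)
  have DI: "R \<in> D \<Longrightarrow> R \<in> IVc L le" for R using D(1) by (auto simp: directed_in_def)
  show "is_lub C leq (ext ` D) (ext s)"
    unfolding is_lub_def
  proof (intro conjI ballI impI)
    show "ext s \<in> C" using ext_C s by blast
    show "leq x (ext s)" if "x \<in> ext ` D" for x using that ext_mono DI s by auto
    fix u assume u: "u \<in> C" "\<forall>x\<in>ext ` D. leq x u"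
    show "leq (ext s) u"
    proof (rule ext_least[OF s(2) u(1)])
      fix b assume "b \<in> s"
      then obtain R where R: "R \<in> D" "b \<in> R" using s by blast
      then have "leq (val b) (ext R)" "leq (ext R) u" using val_leq_ext DI u(2) by auto
      then show "leq (val b) u"
        by (rule leq_trans) (use R DI val_C ext_C u(1) in auto)
    qed
  qed
qed

lemma ext_zero: "ext IV_zero = qzero Q"
  by (rule ext_eqI) (simp add: IV_zero_def is_lub_def zero_C leq_refl)

text \<open>Joint continuity of scaling presents \<open>r (ext R)\<close> as the supremum of the
  \<open>t v\<close> with \<open>t < r\<close> and \<open>v\<close> a value of \<open>R\<close>. For
  positive \<open>t\<close> these are the values of the strings \<open>sc t b\<close> that make up
  \<open>r R\<close>.\<close>

lemma ext_scale:
  assumes R: "R \<in> IVc L le"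
  shows "ext (IV_scale L le r R) = qscale Q r (ext R)"
proof (rule ext_eqI)
  note RI = IVc_IV[OF R]
  \<comment> \<open>The scalar 0 keeps \<open>?E\<close> nonempty for \<open>r = 0\<close>; it
    contributes only the least element.\<close>
  let ?E = "insert 0 {..<r} \<times> val ` R"
  have "is_lub C leq ((\<lambda>(t, v). qscale Q t v) ` ?E) (case (r, ext R) of (t, v) \<Rightarrow> qscale Q t v)"
    by (rule scott_continuousD[OF scale_continuous directed_in_Times is_lub_Times])
      (use ennreal_lub_less directed_val[OF R] ext_lub[OF R] IV_ne[OF RI] in auto)
  then have lub: "qscale Q r (ext R) \<in> C"
    "\<And>t b. t < r \<Longrightarrow> b \<in> R \<Longrightarrow> leq (qscale Q t (val b)) (qscale Q r (ext R))"
    "\<And>u. u \<in> C \<Longrightarrow> (\<And>t b. t = 0 \<or> t < r \<Longrightarrow> b \<in> R \<Longrightarrow> leq (qscale Q t (val b)) u) \<Longrightarrow>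
       leq (qscale Q r (ext R)) u"
    unfolding is_lub_def by auto
  show "is_lub C leq (val ` IV_scale L le r R) (qscale Q r (ext R))"
    unfolding is_lub_def
  proof (intro conjI ballI impI)
    show "qscale Q r (ext R) \<in> C" by (fact lub(1))
    fix x assume "x \<in> val ` IV_scale L le r R"
    then obtain c where c: "c \<in> IV_scale L le r R" "x = val c" by blast
    from RI c(1) show "leq x (qscale Q r (ext R))"
    proof (cases rule: IV_scale_memE)
      case 1
      then show ?thesis using zero_leq lub(1) c(2) by simp
    next
      case (2 t b)
      then show ?thesis using lub(2)[OF 2(3,4)] val_sc[OF R 2(4)] c(2) by simp
    qed
  next
    fix u assume u: "u \<in> C" "\<forall>x\<in>val ` IV_scale L le r R. leq x u"
    show "leq (qscale Q r (ext R)) u"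
    proof (rule lub(3)[OF u(1)])
      fix t b assume t: "t = 0 \<or> t < r" and b: "b \<in> R"
      show "leq (qscale Q t (val b)) u"
      proof (cases "t = 0")
        case True
        then show ?thesis using zero_scale[OF val_C[OF R b]] zero_leq u(1) by simp
      next
        case False
        then have "t < r" using t by blast
        then have "t < top" using top.extremum order_less_le_trans by blast
        then obtain t' where t': "t = ennreal t'" "0 < t'"
          using False by (cases t) (auto simp: less_le)
        then have "sc t' b \<in> IV_scale L le r R" using IV_scale_memI[OF RI b] \<open>t < r\<close> by blast
        then show ?thesis using u(2) val_sc[OF R b, of t'] t' by auto
      qed
    qed
  qed
qed

text \<open>A common upper bound \<open>T\<close> makes all sums \<open>val a + val b\<close> exist,
  since both summands lie below \<open>ext T\<close>. Partial continuity on the product of the two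
  directed sets of values then gives the supremum.\<close>

lemma ext_add:
  assumes "consistent (IVc L le) (\<subseteq>) R S"
  shows "ext (IV_add L le R S) = qadd Q (ext R) (ext S)"
proof (rule ext_eqI)
  obtain T where T: "R \<in> IVc L le" "S \<in> IVc L le" "T \<in> IVc L le" "R \<subseteq> T" "S \<subseteq> T"
    using assms unfolding consistent_def by blast
  have cons_ext: "cons (ext R) (ext S)"
    using consI[of "ext R" "ext T" "ext S"] ext_mono ext_C T by blast
  have cons_val: "cons (val a) (val b)" if "a \<in> R" "b \<in> S" for a b
    by (rule consI[of _ "ext T"]) (use that T val_leq_ext[of T] val_C[of T] ext_C in auto)
  let ?E = "val ` R \<times> val ` S"
  have "is_lub C leq ((\<lambda>(x, y). qadd Q x y) ` ?E) (qadd Q (ext R) (ext S))"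
  proof (rule add_lub[OF directed_in_Times])
    show "is_lub (C \<times> C) (rel_prod leq leq) ?E (ext R, ext S)"
      using ext_lub IV_ne IVc_IV T by (intro is_lub_Times) auto
  qed (use directed_val T cons_val cons_ext in auto)
  moreover have "(\<lambda>(x, y). qadd Q x y) ` ?E = val ` IV_add L le R S"
  proof -
    have "val (a + b) = qadd Q (val a) (val b)" if "a \<in> R" "b \<in> S" for a b
      using that osum_val T cons_val by (intro val_plus) auto
    then show ?thesis
      unfolding IV_add_eq[OF IVc_IV[OF T(1)] IVc_IV[OF T(2)]] by force
  qed
  ultimately show "is_lub C leq (val ` IV_add L le R S) (qadd Q (ext R) (ext S))" by simp
qed

text \<open>Written as \<open>1 (f x)\<close>, the right-hand side is by joint continuity the
  supremum of \<open>t (f y)\<close> with \<open>t < 1\<close> and \<open>y\<close> way below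
  \<open>x\<close>. For positive \<open>t\<close> these are exactly the values of the nonempty
  strings in \<open>eta L le x\<close>.\<close>

lemma ext_eta:
  assumes x: "x \<in> L"
  shows "ext (eta L le x) = f x"
proof (rule ext_eqI)
  let ?W = "{y. wb y x}"
  let ?E = "insert 0 {..<1} \<times> f ` ?W"
  have fW: "directed_in C leq (f ` ?W)"
    by (rule directed_in_image[OF directed_wb[OF x]]) (auto intro: f_C f_mono wbD)
  have "is_lub C leq ((\<lambda>(t, v). qscale Q t v) ` ?E) (case (1, f x) of (t, v) \<Rightarrow> qscale Q t v)"
    by (rule scott_continuousD[OF scale_continuous directed_in_Times is_lub_Times])
      (use ennreal_lub_less[of 1] fW ex_wb[OF x] 
        scott_continuousD[OF f_continuous directed_wb[OF x] lub_wb[OF x]] in auto)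
  then have lub: "\<And>t y. t < 1 \<Longrightarrow> wb y x \<Longrightarrow> leq (qscale Q t (f y)) (f x)"
    "\<And>u. u \<in> C \<Longrightarrow> (\<And>t y. t < 1 \<Longrightarrow> wb y x \<Longrightarrow> leq (qscale Q t (f y)) u) \<Longrightarrow> leq (f x) u"
    using one_scale[OF f_C[OF x]] unfolding is_lub_def by auto
  show "is_lub C leq (val ` eta L le x) (f x)"
    unfolding is_lub_def
  proof (intro conjI ballI impI)
    show "f x \<in> C" by (fact f_C[OF x])
    fix v assume "v \<in> val ` eta L le x"
    then obtain c where c: "c \<in> eta L le x" "v = val c" by blast
    from c(1) show "leq v (f x)"
    proof (cases rule: eta_memE)
      case 1
      then show ?thesis using c(2) zero_leq f_C x by simp
    next
      case (2 r y)
      then show ?thesis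
        using c(2) lub(1)[of "ennreal r" y] val_single[OF wbD(1)[OF 2(4)]]
        by (simp add: ennreal_less_one_iff)
    qed
  next
    fix u assume u: "u \<in> C" "\<forall>v\<in>val ` eta L le x. leq v u"
    show "leq (f x) u"
    proof (rule lub(2)[OF u(1)])
      fix t y assume t: "t < (1::ennreal)" and y: "wb y x"
      show "leq (qscale Q t (f y)) u"
      proof (cases "t = 0")
        case True
        then show ?thesis using zero_scale f_C wbD(1)[OF y] zero_leq u(1) by simp
      next
        case False
        have "t < top" using t top.extremum order_less_le_trans by blast
        then obtain t' where t': "t = ennreal t'" "0 < t'"
          using False by (cases t) (auto simp: less_le)
        then have "{#(t', y)#} \<in> eta L le x"
          using t y by (intro eta_memI) (auto simp: ennreal_less_one_iff)
        then show ?thesis using u(2) val_single[OF wbD(1)[OF y], of t'] t' by auto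
      qed
    qed
  qed
qed

section \<open>Uniqueness of the extension\<close>

lemma hom_DDown:
  assumes hom: "quasi_cone_hom (IVc_cone L le) Q h" and eta: "\<And>x. x \<in> L \<Longrightarrow> h (eta L le x) = f x"
    and b: "b \<in> B_plus L" "bnd b"
  shows "h (DDown L le {b}) = val b \<and> val b \<in> C"
  using b
proof (induction b)
  case empty
  have "DDown L le {{#}} = IV_zero" by (auto simp: DDown_single IV_zero_def)
  then show ?case using hom zero_C by (simp add: quasi_cone_hom_def IVc_cone_def)
next
  case (add p b)
  obtain r x where p: "p = (r, x)" by fastforce
  have r: "0 < r" "x \<in> L" "b \<in> B_plus L" using add.prems by (auto simp: p)
  obtain u where u: "u \<in> L" "\<forall>x\<in>snd ` set_mset (add_mset p b). le x u"
    using add.prems(2) by (auto simp: bnd_def)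
  have bnd: "bnd b" "bnd {#p#}" using u by (auto simp: bnd_def)
  have D: "DDown L le {b} \<in> IVc L le" "DDown L le {{#p#}} \<in> IVc L le"
    "DDown L le {add_mset p b} \<in> IVc L le"
    using IVc_DDown r bnd add.prems by (auto simp: p)
  have eq: "DDown L le {add_mset p b} = IV_add L le (DDown L le {{#p#}}) (DDown L le {b})"
    using DDown_plus[of "{#p#}" b] r by (simp add: p)
  \<comment> \<open>Since each summand contains the empty string, both are subsets of their sum. The
    sum, which lies in the closure, is thus the common upper bound that permits additivity of
    \<open>h\<close>.\<close>
  have "{#} \<in> DDown L le {b}" "{#} \<in> DDown L le {{#p#}}" using IV_empty_mem IVc_IV D by blast+
  then have "DDown L le {{#p#}} \<subseteq> DDown L le {add_mset p b}" "DDown L le {b} \<subseteq> DDown L le {add_mset p b}"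
    unfolding eq IV_add_eq[OF IVc_IV[OF D(2)] IVc_IV[OF D(1)]] by force+
  then have cons: "consistent (IVc L le) (\<subseteq>) (DDown L le {{#p#}}) (DDown L le {b})"
    using D unfolding consistent_def by blast
  have single: "h (DDown L le {{#p#}}) = qscale Q (ennreal r) (f x)"
    unfolding p eta_scale[OF r(1,2), symmetric] eta[OF r(2), symmetric]
    using hom IVc_eta[OF r(2)] by (simp add: quasi_cone_hom_def IVc_cone_def)
  obtain v where v: "osum f (add_mset p b) = Some v" using osum_bnd add.prems by blast
  then have "osum f b = Some (val b)" by (auto simp: p oadd_Some_iff val_def)
  then have "v = qadd Q (qscale Q (ennreal r) (f x)) (val b)"
    using v by (auto simp: p oadd_Some_iff)
  moreover have "h (DDown L le {add_mset p b}) = qadd Q (h (DDown L le {{#p#}})) (h (DDown L le {b}))"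
    unfolding eq using hom cons by (simp add: quasi_cone_hom_def IVc_cone_def)
  ultimately show ?case
    using single add.IH r(3) bnd(1) v osum_C[OF v] by (simp add: val_def)
qed

lemma hom_eq_ext:
  assumes hom: "quasi_cone_hom (IVc_cone L le) Q h" and eta: "\<And>x. x \<in> L \<Longrightarrow> h (eta L le x) = f x"
    and R: "R \<in> IVc L le"
  shows "h R = ext R"
proof (rule ext_eqI[symmetric])
  note RI = IVc_IV[OF R]
  let ?D = "(\<lambda>b. DDown L le {b}) ` R"
  have D: "directed_in (IVc L le) (\<subseteq>) ?D" "\<Union>?D = R"
    using IV_directed_DDown[OF RI, of "IVc L le"] IVc_DDown IV_B_plus[OF RI] IVc_bnd[OF R] by auto
  then have "is_lub (IVc L le) (\<subseteq>) ?D R" using is_lub_IVc_iff by blast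
  moreover have "scott_continuous (IVc L le) (\<subseteq>) C leq h"
    using hom by (simp add: quasi_cone_hom_def IVc_cone_def)
  ultimately have "is_lub C leq (h ` ?D) (h R)" using scott_continuousD D(1) by metis
  moreover have "h ` ?D = val ` R"
    unfolding image_image
    using hom_DDown[OF hom eta] IV_B_plus[OF RI] IVc_bnd[OF R] by (intro image_cong) auto
  ultimately show "is_lub C leq (val ` R) (h R)" by simp
qed

lemma ext_hom: "quasi_cone_hom (IVc_cone L le) Q (restrict ext (IVc L le))"
proof -
  have sel: "qcarrier (IVc_cone L le) = IVc L le" "qle (IVc_cone L le) = (\<subseteq>)"
    "qadd (IVc_cone L le) = IV_add L le" "qscale (IVc_cone L le) = IV_scale L le"
    "qzero (IVc_cone L le) = IV_zero"
    by (auto simp: IVc_cone_def)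
  have "scott_continuous (IVc L le) (\<subseteq>) C leq (restrict ext (IVc L le))"
    unfolding scott_continuous_def
  proof (intro conjI allI impI; (elim conjE)?)
    fix D s assume D: "directed_in (IVc L le) (\<subseteq>) D" "is_lub (IVc L le) (\<subseteq>) D s"
    then have "restrict ext (IVc L le) ` D = ext ` D" "s \<in> IVc L le"
      by (auto simp: directed_in_def is_lub_def image_def)
    then show "is_lub C leq (restrict ext (IVc L le) ` D) (restrict ext (IVc L le) s)"
      using scott_continuousD[OF ext_continuous D] by simp
  qed (use ext_C in auto)
  moreover have "restrict ext (IVc L le) (IV_add L le R S) =
      qadd Q (restrict ext (IVc L le) R) (restrict ext (IVc L le) S)"
    if "consistent (IVc L le) (\<subseteq>) R S" for R S
    using IVc_add[OF that] ext_add[OF that] that by (simp add: consistent_def)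
  ultimately show ?thesis
    unfolding quasi_cone_hom_def sel
    using IVc_zero IVc_scale by (simp add: ext_zero ext_scale)
qed

text \<open>A function is constrained only on the carrier; extensionality fixes its values
  elsewhere, so that uniqueness becomes equality of functions.\<close>

lemma ex1_hom:
  "\<exists>!h. h \<in> extensional (IVc L le) \<and> quasi_cone_hom (IVc_cone L le) Q h \<and>
     (\<forall>x\<in>L. h (eta L le x) = f x)"
proof (rule ex1I[of _ "restrict ext (IVc L le)"])
  show "restrict ext (IVc L le) \<in> extensional (IVc L le) \<and>
    quasi_cone_hom (IVc_cone L le) Q (restrict ext (IVc L le)) \<and>
    (\<forall>x\<in>L. restrict ext (IVc L le) (eta L le x) = f x)"
    using ext_hom IVc_eta ext_eta by simp
  fix h assume h: "h \<in> extensional (IVc L le) \<and> quasi_cone_hom (IVc_cone L le) Q h \<and>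
    (\<forall>x\<in>L. h (eta L le x) = f x)"
  show "h = restrict ext (IVc L le)"
  proof (rule extensionalityI[of _ "IVc L le"])
    show "h R = restrict ext (IVc L le) R" if "R \<in> IVc L le" for R
      using hom_eq_ext[of h R] h that by simp
  qed (use h in auto)
qed

end

theorem theorem4p9:
  fixes L :: "'a set" and le :: "'a \<Rightarrow> 'a \<Rightarrow> bool"
  assumes "continuous_dcpo L le"
  shows "(\<forall>R S. consistent (IVc L le) (\<subseteq>) R S \<longrightarrow> IV_add L le R S \<in> IVc L le) \<and>
    (\<forall>r. \<forall>R\<in>IVc L le. IV_scale L le r R \<in> IVc L le) \<and>
    IV_zero \<in> IVc L le \<and>
    consistent_dcpo_quasi_cone (IVc_cone L le) \<and>
    scott_continuous L le (IVc L le) (\<subseteq>) (eta L le) \<and>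
    (\<forall>(Q :: 'q quasi_cone) f.
       consistent_dcpo_quasi_cone Q \<and> scott_continuous L le (qcarrier Q) (qle Q) f \<longrightarrow>
       (\<exists>!h. h \<in> extensional (IVc L le) \<and> quasi_cone_hom (IVc_cone L le) Q h \<and>
          (\<forall>x\<in>L. h (eta L le x) = f x)))"
proof -
  interpret cont_dcpo L le by standard (fact assms)
  have "\<exists>!h. h \<in> extensional (IVc L le) \<and> quasi_cone_hom (IVc_cone L le) Q h \<and>
      (\<forall>x\<in>L. h (eta L le x) = f x)"
    if "consistent_dcpo_quasi_cone Q" "scott_continuous L le (qcarrier Q) (qle Q) f"
    for Q :: "'q quasi_cone" and f
  proof -
    interpret cone_extension L le Q f by standard (fact that)+
    show ?thesis by (fact ex1_hom)
  qed
  then show ?thesis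
    using IVc_add IVc_scale IVc_zero IVc_consistent_dcpo_quasi_cone eta_scott_continuous
    by (intro conjI allI impI ballI; (elim conjE)?)
qed

end
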